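(* Let $\mathcal H$ be a finite-dimensional complex Hilbert space, $H=H^\dagger$ a Hamiltonian on $\mathcal H$, $|\psi\rangle\in\mathcal H$ a unit vector that is not an eigenvector of $H$, and $|\psi_t\rangle=e^{-itH}|\psi\rangle$, $t\in\mathbb R$. For each eigenvalue $E$ of $H$ let $p_E$ be the probability that a measurement of $H$ on $|\psi\rangle$ gives outcome $E$; let $K$ be the number of eigenvalues $E$ with $p_E\neq 0$, and let $p_{\min}=\min\{p_E: p_E\ne 0\}$. Then for all integers $M\ge N\ge 1/p_{\min}$ there exists a probabilistic replication process $\mathcal P_{\mathrm{yes}}$ from $N$ to $M$ copies, with nonzero success probability on every input $|\psi_t\rangle^{\otimes N}$, whose fidelity satisfies $$F[\mathcal P_{\mathrm{yes}}]\ \ge\ 1-2K\exp\!\left(-\frac{2\,p_{\min}^2N^2}{M}+\frac{4N}{MK}\right).$$ In particular, if $M=M(N)$ is of order $N^{\alpha}$ with $1\le \alpha<2$ (and $M(N)\ge N$), there are probabilistic replication processes from $N$ to $M(N)$ copies whose fidelity approaches $1$ faster than the inverse of any polynomial in $N$ as $N\to\infty$.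
   Context: A (probabilistic) replication process from $N$ to $M$ copies is a completely positive, trace non-increasing linear map $\mathcal P_{\mathrm{yes}}$ from operators on $\mathcal H^{\otimes N}$ to operators on $\mathcal H^{\otimes M}$ (the "successful" branch of a quantum instrument). Its success probability on input $|\psi_t\rangle^{\otimes N}$ is $\mathrm{Tr}\big[\mathcal P_{\mathrm{yes}}\big((|\psi_t\rangle\langle\psi_t|)^{\otimes N}\big)\big]$, and its (worst-case, global) fidelity is $$F[\mathcal P_{\mathrm{yes}}]=\inf_{t\in\mathbb R}\frac{\langle\psi_t|^{\otimes M}\,\mathcal P_{\mathrm{yes}}\big((|\psi_t\rangle\langle\psi_t|)^{\otimes N}\big)\,|\psi_t\rangle^{\otimes M}}{\mathrm{Tr}\big[\mathcal P_{\mathrm{yes}}\big((|\psi_t\rangle\langle\psi_t|)^{\otimes N}\big)\big]}.$$ *)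

theory Defs
  imports
    Complex_Main
    "HOL-Library.Landau_Symbols"
    "HOL-Computational_Algebra.Polynomial"
    "Jordan_Normal_Form.Schur_Decomposition"
begin

text \<open>A \<open>d\<close>-dimensional complex Hilbert space is represented, via an orthonormal basis, by
  \<open>carrier_vec d\<close> over the complex numbers, and its operators by \<open>carrier_mat d d\<close>.  The inner
  product \<open>v \<bullet>c w\<close> conjugates its second argument, so that \<open>\<langle>\<phi>|A|\<phi>\<rangle>\<close> is \<open>(A *\<^sub>v \<phi>) \<bullet>c \<phi>\<close>.\<close>

definition hermitian_mat :: "nat \<Rightarrow> complex mat \<Rightarrow> bool" where
  "hermitian_mat d A \<longleftrightarrow> A \<in> carrier_mat d d \<and> mat_adjoint A = A"

definition psd_mat :: "nat \<Rightarrow> complex mat \<Rightarrow> bool" where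
  \<comment> \<open>in the order on the complex numbers, \<open>0 \<le> z\<close> says that \<open>z\<close> is real and nonnegative\<close>
  "psd_mat d A \<longleftrightarrow>
     A \<in> carrier_mat d d \<and> (\<forall>v \<in> carrier_vec d. 0 \<le> (A *\<^sub>v v) \<bullet>c v)"

definition mat_trace :: "complex mat \<Rightarrow> complex" where
  "mat_trace A = (\<Sum>i<dim_row A. A $$ (i, i))"

definition mat_exp :: "complex mat \<Rightarrow> complex mat" where
  "mat_exp A = mat (dim_row A) (dim_col A) (\<lambda>(i, j). \<Sum>k. (A ^\<^sub>m k) $$ (i, j) / fact k)"

definition evolved :: "complex mat \<Rightarrow> complex vec \<Rightarrow> real \<Rightarrow> complex vec" where
  "evolved H \<psi> t = mat_exp ((- \<i> * complex_of_real t) \<cdot>\<^sub>m H) *\<^sub>v \<psi>"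

definition ketbra :: "complex vec \<Rightarrow> complex mat" where
  "ketbra v = mat (dim_vec v) (dim_vec v) (\<lambda>(i, j). v $ i * cnj (v $ j))"


subsection \<open>Energy measurement\<close>

text \<open>The orthogonal projector onto the \<open>E\<close>-eigenspace of \<open>H\<close> is the unique self-adjoint
  idempotent whose range is that eigenspace.\<close>

definition eigenprojector :: "complex mat \<Rightarrow> complex \<Rightarrow> complex mat" where
  "eigenprojector H E =
     (THE P. P \<in> carrier_mat (dim_row H) (dim_row H) \<and> mat_adjoint P = P \<and> P * P = P \<and>
        (\<lambda>v. P *\<^sub>v v) ` carrier_vec (dim_row H) =
          {v \<in> carrier_vec (dim_row H). H *\<^sub>v v = E \<cdot>\<^sub>v v})"

definition outcome_prob :: "complex mat \<Rightarrow> complex vec \<Rightarrow> complex \<Rightarrow> real" where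
  "outcome_prob H \<psi> E = Re ((eigenprojector H E *\<^sub>v \<psi>) \<bullet>c \<psi>)"

definition energy_support :: "complex mat \<Rightarrow> complex vec \<Rightarrow> complex set" where
  "energy_support H \<psi> = {E. eigenvalue H E \<and> outcome_prob H \<psi> E \<noteq> 0}"

definition num_energies :: "complex mat \<Rightarrow> complex vec \<Rightarrow> nat" where
  "num_energies H \<psi> = card (energy_support H \<psi>)"

definition p_min :: "complex mat \<Rightarrow> complex vec \<Rightarrow> real" where
  "p_min H \<psi> = Min (outcome_prob H \<psi> ` energy_support H \<psi>)"


subsection \<open>Tensor powers\<close>

text \<open>The basis vector \<open>e\<^sub>a \<otimes> e\<^sub>b\<close> of a product of spaces of dimensions \<open>m\<close> and \<open>n\<close> has index
  \<open>a * n + b\<close>.\<close>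

definition kron_vec :: "complex vec \<Rightarrow> complex vec \<Rightarrow> complex vec" where
  "kron_vec v w = vec (dim_vec v * dim_vec w)
     (\<lambda>i. v $ (i div dim_vec w) * w $ (i mod dim_vec w))"

definition kron_mat :: "complex mat \<Rightarrow> complex mat \<Rightarrow> complex mat" where
  "kron_mat A B = mat (dim_row A * dim_row B) (dim_col A * dim_col B)
     (\<lambda>(i, j). A $$ (i div dim_row B, j div dim_col B) * B $$ (i mod dim_row B, j mod dim_col B))"

primrec tensor_pow_vec :: "complex vec \<Rightarrow> nat \<Rightarrow> complex vec" where
  "tensor_pow_vec v 0 = vec 1 (\<lambda>_. 1)"
| "tensor_pow_vec v (Suc n) = kron_vec v (tensor_pow_vec v n)"

primrec tensor_pow_mat :: "complex mat \<Rightarrow> nat \<Rightarrow> complex mat" where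
  "tensor_pow_mat A 0 = 1\<^sub>m 1"
| "tensor_pow_mat A (Suc n) = kron_mat A (tensor_pow_mat A n)"


subsection \<open>Replication processes\<close>

text \<open>Maps on operators are functions on \<open>complex mat\<close> of which only the values on the carrier
  \<open>carrier_mat m m\<close> matter.\<close>

definition linear_mat_map :: "nat \<Rightarrow> nat \<Rightarrow> (complex mat \<Rightarrow> complex mat) \<Rightarrow> bool" where
  "linear_mat_map m n \<P> \<longleftrightarrow>
     (\<forall>A \<in> carrier_mat m m. \<P> A \<in> carrier_mat n n) \<and>
     (\<forall>A \<in> carrier_mat m m. \<forall>B \<in> carrier_mat m m. \<P> (A + B) = \<P> A + \<P> B) \<and>
     (\<forall>c. \<forall>A \<in> carrier_mat m m. \<P> (c \<cdot>\<^sub>m A) = c \<cdot>\<^sub>m \<P> A)"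

text \<open>The map \<open>id\<^sub>k \<otimes> \<P>\<close>: an operator on \<open>\<complex>\<^sup>k \<otimes> \<complex>\<^sup>m\<close> is a \<open>k \<times> k\<close> array of \<open>m \<times> m\<close> blocks, and
  \<open>\<P>\<close> is applied to each block.\<close>

definition ampliation ::
  "nat \<Rightarrow> nat \<Rightarrow> nat \<Rightarrow> (complex mat \<Rightarrow> complex mat) \<Rightarrow> complex mat \<Rightarrow> complex mat" where
  "ampliation k m n \<P> X = mat (k * n) (k * n)
     (\<lambda>(i, j). \<P> (mat m m (\<lambda>(a, b). X $$ ((i div n) * m + a, (j div n) * m + b)))
        $$ (i mod n, j mod n))"

definition completely_positive :: "nat \<Rightarrow> nat \<Rightarrow> (complex mat \<Rightarrow> complex mat) \<Rightarrow> bool" where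
  "completely_positive m n \<P> \<longleftrightarrow>
     (\<forall>k X. psd_mat (k * m) X \<longrightarrow> psd_mat (k * n) (ampliation k m n \<P> X))"

definition trace_nonincreasing :: "nat \<Rightarrow> (complex mat \<Rightarrow> complex mat) \<Rightarrow> bool" where
  "trace_nonincreasing m \<P> \<longleftrightarrow>
     (\<forall>A. psd_mat m A \<longrightarrow> Re (mat_trace (\<P> A)) \<le> Re (mat_trace A))"

definition replication_process ::
  "nat \<Rightarrow> nat \<Rightarrow> nat \<Rightarrow> (complex mat \<Rightarrow> complex mat) \<Rightarrow> bool" where
  "replication_process d N M \<P> \<longleftrightarrow>
     linear_mat_map (d ^ N) (d ^ M) \<P> \<and> completely_positive (d ^ N) (d ^ M) \<P> \<and>
     trace_nonincreasing (d ^ N) \<P>"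

definition success_prob ::
  "nat \<Rightarrow> (complex mat \<Rightarrow> complex mat) \<Rightarrow> complex vec \<Rightarrow> real" where
  "success_prob N \<P> \<phi> = Re (mat_trace (\<P> (tensor_pow_mat (ketbra \<phi>) N)))"

text \<open>For a replication process the quotients are nonnegative, so the infimum is that of a
  nonempty set of reals bounded below.\<close>

definition fidelity ::
  "nat \<Rightarrow> nat \<Rightarrow> (complex mat \<Rightarrow> complex mat) \<Rightarrow> (real \<Rightarrow> complex vec) \<Rightarrow> real" where
  "fidelity N M \<P> \<phi> =
     (INF t. Re ((\<P> (tensor_pow_mat (ketbra (\<phi> t)) N) *\<^sub>v tensor_pow_vec (\<phi> t) M)
                   \<bullet>c tensor_pow_vec (\<phi> t) M)
             / success_prob N \<P> (\<phi> t))"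

end

theory Submission
  imports Defs "HOL-Real_Asymp.Real_Asymp"
begin

text \<open>Expand \<open>\<psi>\<close> in its energy components \<open>g E\<close>, of squared norm \<open>p E\<close>.  The \<open>M\<close>-fold tensor power
  of the evolved state is then a sum over words of \<open>M\<close> energies, in which time enters only through a
  phase determined by the multiset of letters.  Fix a multiset \<open>m\<close> of \<open>M - N\<close> energies in
  proportions close to \<open>p\<close>.  Words of length \<open>M\<close> containing \<open>m\<close> can be reached from words of length
  \<open>N\<close> by adding \<open>m\<close>, which changes the phase by a factor independent of the word; so a single Kraus
  operator turns the \<open>N\<close>-fold power, for all times at once, into the part of the \<open>M\<close>-fold power
  supported on words containing \<open>m\<close>.  The fidelity is the probability that a random word of length
  \<open>M\<close> contains \<open>m\<close>.  Since the count of \<open>E\<close> in \<open>m\<close> is less than \<open>(M - N) p E + 1\<close>, a failure forces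
  some count to fall \<open>N p E\<close> below its mean, and Hoeffding's bound applies.\<close>

subsection \<open>Vectors and adjoints\<close>

text \<open>The fidelity is a quotient by the success probability, and that probability only has to
  be nonzero. So the Kraus operator may be shrunk by any positive factor until the trace does not
  increase; no sharp norm estimate is needed, and the price is paid in success probability alone.
  The proportions of \<open>m\<close> balance the letters. A typical word of length \<open>M\<close>
  contains about \<open>M * p E\<close> letters \<open>E\<close>, while \<open>m\<close> asks for
  about \<open>(M - N) * p E\<close>, which leaves a margin of \<open>N * p E\<close> for every
  letter at once. Fluctuations are of the order of the square root of \<open>M\<close>, so the
  margin wins once \<open>N^2\<close> dominates \<open>M\<close>: this is the origin of the exponent
  \<open>N^2 / M\<close> and of the threshold 2 for \<alpha>. A union bound over the energies gives
  the error \<open>num_energies * exp (- 2 * p_min^2 * N^2 / M)\<close>, which lies below the error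
  claimed. Since \<open>outcome_prob\<close> rests on a definite description of the eigenprojector,
  existence and uniqueness of that projector have to be proved before any probability can be
  computed.\<close>

lemma cscalar_eq_sum:
  fixes x y :: "complex vec"
  shows "x \<bullet>c y = (\<Sum>i<dim_vec y. x $ i * cnj (y $ i))"
  by (simp add: scalar_prod_def atLeast0LessThan conjugate_complex_def)

lemma cscalar_cnj:
  fixes x y :: "complex vec"
  assumes "dim_vec x = dim_vec y"
  shows "cnj (x \<bullet>c y) = y \<bullet>c x"
  using assms by (simp add: cscalar_eq_sum mult.commute)

lemma cscalar_diff_left:
  fixes x y z :: "complex vec"
  assumes "x \<in> carrier_vec d" "y \<in> carrier_vec d" "z \<in> carrier_vec d"
  shows "(x - y) \<bullet>c z = x \<bullet>c z - y \<bullet>c z"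
  using assms by (simp add: cscalar_eq_sum sum_subtractf algebra_simps)

lemma cscalar_smult_left:
  fixes x y :: "complex vec"
  assumes "x \<in> carrier_vec d" "y \<in> carrier_vec d"
  shows "(c \<cdot>\<^sub>v x) \<bullet>c y = c * (x \<bullet>c y)"
  using assms by (simp add: cscalar_eq_sum sum_distrib_left algebra_simps)

lemma cscalar_smult_right:
  fixes x y :: "complex vec"
  assumes "x \<in> carrier_vec d" "y \<in> carrier_vec d"
  shows "x \<bullet>c (c \<cdot>\<^sub>v y) = cnj c * (x \<bullet>c y)"
  using assms by (simp add: cscalar_eq_sum sum_distrib_left algebra_simps)

lemma cscalar_self: "x \<bullet>c x = complex_of_real (\<Sum>i<dim_vec x. (cmod (x $ i))\<^sup>2)"
  by (simp add: cscalar_eq_sum complex_norm_square of_real_sum del: of_real_power)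

text \<open>Vectors of all dimensions share one type, so an empty sum has no dimension of its own;
  \<open>d\<close> is therefore passed explicitly and the coordinates are summed.\<close>

definition vec_sum :: "nat \<Rightarrow> 'a set \<Rightarrow> ('a \<Rightarrow> complex vec) \<Rightarrow> complex vec" where
  "vec_sum d S g = vec d (\<lambda>i. \<Sum>a\<in>S. g a $ i)"

lemma vec_sum_carrier [simp]: "vec_sum d S g \<in> carrier_vec d"
  and vec_sum_dim [simp]: "dim_vec (vec_sum d S g) = d"
  and vec_sum_index [simp]: "i < d \<Longrightarrow> vec_sum d S g $ i = (\<Sum>a\<in>S. g a $ i)"
  by (simp_all add: vec_sum_def)

lemma cscalar_vec_sum_left:
  assumes "y \<in> carrier_vec d"
  shows "vec_sum d S g \<bullet>c y = (\<Sum>a\<in>S. g a \<bullet>c y)"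
  using assms by (simp add: cscalar_eq_sum sum_distrib_right) (rule sum.swap)

lemma cscalar_vec_sum_right:
  assumes "\<And>a. a \<in> S \<Longrightarrow> g a \<in> carrier_vec d"
  shows "x \<bullet>c vec_sum d S g = (\<Sum>a\<in>S. x \<bullet>c g a)"
proof -
  have "x \<bullet>c vec_sum d S g = (\<Sum>a\<in>S. \<Sum>i<d. x $ i * cnj (g a $ i))"
    by (simp add: cscalar_eq_sum sum_distrib_left) (rule sum.swap)
  also have "\<dots> = (\<Sum>a\<in>S. x \<bullet>c g a)"
    using assms by (intro sum.cong) (auto simp: cscalar_eq_sum dest!: carrier_vecD)
  finally show ?thesis .
qed

lemma mult_mat_vec_index:
  assumes "A \<in> carrier_mat n m" "v \<in> carrier_vec m" "i < n"
  shows "(A *\<^sub>v v) $ i = (\<Sum>j<m. A $$ (i, j) * v $ j)"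
  using assms by (simp add: scalar_prod_def atLeast0LessThan)

lemma mult_mat_vec_sum:
  fixes A :: "complex mat"
  assumes A: "A \<in> carrier_mat n m" and g: "\<And>a. a \<in> S \<Longrightarrow> g a \<in> carrier_vec m"
  shows "A *\<^sub>v vec_sum m S g = vec_sum n S (\<lambda>a. A *\<^sub>v g a)"
proof (rule eq_vecI)
  fix i assume "i < dim_vec (vec_sum n S (\<lambda>a. A *\<^sub>v g a))"
  hence i: "i < n" by simp
  have "(A *\<^sub>v vec_sum m S g) $ i = (\<Sum>j<m. \<Sum>a\<in>S. A $$ (i, j) * g a $ j)"
    using A i by (simp add: mult_mat_vec_index sum_distrib_left del: index_mult_mat_vec)
  also have "\<dots> = (\<Sum>a\<in>S. \<Sum>j<m. A $$ (i, j) * g a $ j)" by (rule sum.swap)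
  also have "\<dots> = (\<Sum>a\<in>S. (A *\<^sub>v g a) $ i)"
    using A i g by (intro sum.cong refl) (simp add: mult_mat_vec_index del: index_mult_mat_vec)
  finally show "(A *\<^sub>v vec_sum m S g) $ i = vec_sum n S (\<lambda>a. A *\<^sub>v g a) $ i"
    using i by simp
qed (use A in auto)

lemma mat_adjoint_carrier [simp]:
  fixes A :: "complex mat"
  shows "A \<in> carrier_mat n m \<Longrightarrow> mat_adjoint A \<in> carrier_mat m n"
  by (auto simp: mat_adjoint_def intro!: carrier_matI)

lemma mat_adjoint_index:
  fixes A :: "complex mat"
  assumes "A \<in> carrier_mat n m" "i < m" "j < n"
  shows "mat_adjoint A $$ (i, j) = cnj (A $$ (j, i))"
  using assms by (auto simp: mat_adjoint_def conjugate_complex_def mat_of_rows_index)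

lemma cscalar_adjoint:
  fixes A :: "complex mat"
  assumes A: "A \<in> carrier_mat n m" and x: "x \<in> carrier_vec m" and y: "y \<in> carrier_vec n"
  shows "(A *\<^sub>v x) \<bullet>c y = x \<bullet>c (mat_adjoint A *\<^sub>v y)"
proof -
  have "(A *\<^sub>v x) \<bullet>c y = (\<Sum>i<n. \<Sum>j<m. A $$ (i, j) * x $ j * cnj (y $ i))"
    using assms by (simp add: cscalar_eq_sum mult_mat_vec_index sum_distrib_right del: index_mult_mat_vec)
  also have "\<dots> = (\<Sum>j<m. \<Sum>i<n. A $$ (i, j) * x $ j * cnj (y $ i))" by (rule sum.swap)
  also have "\<dots> = (\<Sum>j<m. x $ j * cnj ((mat_adjoint A *\<^sub>v y) $ j))"
    using assms
    by (intro sum.cong refl)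
       (simp add: mult_mat_vec_index[OF mat_adjoint_carrier] mat_adjoint_index sum_distrib_left
          algebra_simps del: index_mult_mat_vec)
  also have "\<dots> = x \<bullet>c (mat_adjoint A *\<^sub>v y)"
    using mat_adjoint_carrier[OF A] by (simp add: cscalar_eq_sum)
  finally show ?thesis .
qed

subsection \<open>The spectral decomposition\<close>

definition eigenspace :: "complex mat \<Rightarrow> complex \<Rightarrow> complex vec set" where
  "eigenspace H E = {v \<in> carrier_vec (dim_row H). H *\<^sub>v v = E \<cdot>\<^sub>v v}"

locale hermitian =
  fixes d :: nat and H :: "complex mat"
  assumes hermitian: "hermitian_mat d H"
begin

lemma H_carrier [simp]: "H \<in> carrier_mat d d"
  using hermitian by (simp add: hermitian_mat_def)

lemma dim_H [simp]: "dim_row H = d" "dim_col H = d"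
  using carrier_matD[OF H_carrier] by auto

lemma mult_H_carrier [simp]: "v \<in> carrier_vec d \<Longrightarrow> H *\<^sub>v v \<in> carrier_vec d"
  by (rule mult_mat_vec_carrier[OF H_carrier])

lemma H_swap:
  assumes "x \<in> carrier_vec d" "y \<in> carrier_vec d"
  shows "(H *\<^sub>v x) \<bullet>c y = x \<bullet>c (H *\<^sub>v y)"
  using cscalar_adjoint[OF H_carrier assms] hermitian by (simp add: hermitian_mat_def)

lemma eigenspaceD [dest]:
  assumes "v \<in> eigenspace H E" shows "v \<in> carrier_vec d" "H *\<^sub>v v = E \<cdot>\<^sub>v v"
  using assms by (auto simp: eigenspace_def)

lemma eigenspaceI:
  assumes "v \<in> carrier_vec d" "H *\<^sub>v v = E \<cdot>\<^sub>v v" shows "v \<in> eigenspace H E"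
  using assms by (auto simp: eigenspace_def)

lemma zero_eigenspace [simp]: "0\<^sub>v d \<in> eigenspace H E"
  by (intro eigenspaceI) (auto simp: scalar_prod_def intro!: eq_vecI)

lemma eigenspace_add:
  assumes "v \<in> eigenspace H E" "w \<in> eigenspace H E" shows "v + w \<in> eigenspace H E"
  using assms[THEN eigenspaceD(1)] assms[THEN eigenspaceD(2)]
  by (intro eigenspaceI) (auto simp: mult_add_distrib_mat_vec[OF H_carrier] smult_add_distrib_vec)

lemma eigenspace_smult:
  assumes "v \<in> eigenspace H E" shows "c \<cdot>\<^sub>v v \<in> eigenspace H E"
  using assms[THEN eigenspaceD(1)] assms[THEN eigenspaceD(2)]
  by (intro eigenspaceI) (auto simp: mult_mat_vec[OF H_carrier] smult_smult_assoc mult.commute)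

lemma eigenspace_diff:
  assumes "v \<in> eigenspace H E" "w \<in> eigenspace H E" shows "v - w \<in> eigenspace H E"
proof -
  have "v - w = v + (-1) \<cdot>\<^sub>v w" using assms[THEN eigenspaceD(1)] by (intro eq_vecI) auto
  thus ?thesis using assms by (simp add: eigenspace_add eigenspace_smult)
qed

lemma eigenspace_real:
  assumes v: "v \<in> eigenspace H E" and "v \<noteq> 0\<^sub>v d" shows "cnj E = E"
proof -
  have c: "v \<in> carrier_vec d" and e: "H *\<^sub>v v = E \<cdot>\<^sub>v v" using v by auto
  have "E * (v \<bullet>c v) = cnj E * (v \<bullet>c v)"
    using H_swap[OF c c] c by (simp add: e cscalar_smult_left[OF c c] cscalar_smult_right[OF c c])
  thus ?thesis using c assms(2) by simp
qed

lemma eigenspace_orthogonal: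
  assumes x: "x \<in> eigenspace H E" and y: "y \<in> eigenspace H F" and "E \<noteq> F"
  shows "x \<bullet>c y = 0"
\<comment> \<open>The number \<open>F\<close> is known to be real only through a nonzero
  eigenvector, so \<open>y = 0\<close> is split off.\<close>
proof (cases "y = 0\<^sub>v d")
  case True thus ?thesis using x by (auto simp: cscalar_eq_sum)
next
  case False
  have cx: "x \<in> carrier_vec d" and cy: "y \<in> carrier_vec d" using x y by auto
  have "E * (x \<bullet>c y) = F * (x \<bullet>c y)"
    using H_swap[OF cx cy] eigenspace_real[OF y False] eigenspaceD(2)[OF x] eigenspaceD(2)[OF y]
    by (simp add: cscalar_smult_left[OF cx cy] cscalar_smult_right[OF cx cy])
  thus ?thesis using \<open>E \<noteq> F\<close> by simp
qed

text \<open>For \<open>w = H v - a v\<close>, self-adjointness moves \<open>H - a\<close> to the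
  other factor: \<open>w \<bullet>c w\<close> becomes the product of \<open>v\<close> with
  \<open>(H - a) w = 0\<close>. The move needs \<open>a\<close> to be real, which
  \<open>w \<noteq> 0\<close> provides.\<close>

lemma no_jordan_block:
  assumes v: "v \<in> carrier_vec d" and w: "H *\<^sub>v v - a \<cdot>\<^sub>v v \<in> eigenspace H a"
  shows "H *\<^sub>v v = a \<cdot>\<^sub>v v"
proof -
  define w where "w = H *\<^sub>v v - a \<cdot>\<^sub>v v"
  have cw: "w \<in> carrier_vec d" and Hv: "H *\<^sub>v v \<in> carrier_vec d" using v by (auto simp: w_def)
  have w': "w \<in> eigenspace H a" using w by (simp add: w_def)
  have "w = 0\<^sub>v d"
  proof (rule ccontr)
    assume nz: "w \<noteq> 0\<^sub>v d"
    have "w \<bullet>c w = (H *\<^sub>v v) \<bullet>c w - (a \<cdot>\<^sub>v v) \<bullet>c w"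
      using cscalar_diff_left[OF Hv smult_carrier_vec[THEN iffD2, OF v] cw, of a] by (simp add: w_def)
    also have "\<dots> = 0"
      using H_swap[OF v cw] eigenspaceD(2)[OF w'] eigenspace_real[OF w' nz]
      by (simp add: cscalar_smult_left[OF v cw] cscalar_smult_right[OF v cw])
    finally show False using nz cw by simp
  qed
  hence "\<And>i. i < d \<Longrightarrow> (H *\<^sub>v v) $ i - a * v $ i = 0"
    unfolding w_def using v by (metis Hv carrier_vecD index_minus_vec(1) index_smult_vec(1) index_zero_vec(1) index_smult_vec(2))
  thus ?thesis using v by (intro eq_vecI) (auto simp del: index_mult_mat_vec)
qed

abbreviation "Spec \<equiv> Collect (eigenvalue H)"

lemma finite_Spec: "finite Spec"
proof -
  have "char_poly H \<noteq> 0" using degree_monic_char_poly[OF H_carrier] by auto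
  thus ?thesis using poly_roots_finite[of "char_poly H"]
    by (simp add: eigenvalue_root_char_poly[OF H_carrier, abs_def])
qed

lemma eigenspace_trivial:
  assumes "v \<in> eigenspace H E" "E \<notin> Spec" shows "v = 0\<^sub>v d"
  using assms by (auto simp: eigenvalue_def eigenvector_def eigenspace_def)

text \<open>Components are requested for every complex number, so that families can be added and
  scaled without membership conditions; off the spectrum they are forced to vanish.\<close>

definition decomposable :: "complex vec \<Rightarrow> bool" where
  "decomposable v \<longleftrightarrow> (\<exists>g. (\<forall>a. g a \<in> eigenspace H a) \<and> v = vec_sum d Spec g)"

lemma decomposable_add:
  assumes "decomposable v" "decomposable w" shows "decomposable (v + w)"
proof -
  obtain g h where g: "\<And>a. g a \<in> eigenspace H a" "v = vec_sum d Spec g"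
    and h: "\<And>a. h a \<in> eigenspace H a" "w = vec_sum d Spec h"
    using assms unfolding decomposable_def by blast
  have "v + w = vec_sum d Spec (\<lambda>a. g a + h a)"
    using carrier_vecD[OF eigenspaceD(1)[OF g(1)]] carrier_vecD[OF eigenspaceD(1)[OF h(1)]]
    by (intro eq_vecI) (simp_all add: g(2) h(2) sum.distrib)
  thus ?thesis unfolding decomposable_def
    using g(1) h(1) by (intro exI[of _ "\<lambda>a. g a + h a"]) (auto intro: eigenspace_add)
qed

lemma decomposable_smult:
  assumes "decomposable v" shows "decomposable (c \<cdot>\<^sub>v v)"
proof -
  obtain g where g: "\<And>a. g a \<in> eigenspace H a" "v = vec_sum d Spec g"
    using assms unfolding decomposable_def by blast
  have "c \<cdot>\<^sub>v v = vec_sum d Spec (\<lambda>a. c \<cdot>\<^sub>v g a)"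
    using carrier_vecD[OF eigenspaceD(1)[OF g(1)]]
    by (intro eq_vecI) (auto simp: g(2) sum_distrib_left intro!: sum.cong)
  thus ?thesis unfolding decomposable_def
    using g(1) by (intro exI[of _ "\<lambda>a. c \<cdot>\<^sub>v g a"]) (auto intro: eigenspace_smult)
qed

lemma decomposable_zero: "decomposable (0\<^sub>v d)"
  unfolding decomposable_def by (intro exI[of _ "\<lambda>_. 0\<^sub>v d"]) (auto intro!: eq_vecI)

lemma decomposable_vec_sum:
  assumes "finite S" "\<And>a. a \<in> S \<Longrightarrow> decomposable (g a)" "\<And>a. a \<in> S \<Longrightarrow> g a \<in> carrier_vec d"
  shows "decomposable (vec_sum d S g)"
  using assms
proof (induction S rule: finite_induct)
  case empty
  have "vec_sum d {} g = 0\<^sub>v d" by (intro eq_vecI) auto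
  thus ?case by (simp add: decomposable_zero)
next
  case (insert x S)
  have "vec_sum d (insert x S) g = g x + vec_sum d S g"
    using insert by (intro eq_vecI) auto
  thus ?case using insert by (auto intro: decomposable_add)
qed

text \<open>If \<open>(H - a) v\<close> has eigencomponents \<open>g\<close>, then subtracting \<open>g b / (b - a)\<close> for \<open>b \<noteq> a\<close> from
  \<open>v\<close> leaves a vector \<open>u\<close> with \<open>(H - a)\<^sup>2 u = 0\<close>, hence an \<open>a\<close>-eigenvector.\<close>

lemma decomposable_step:
  assumes v: "v \<in> carrier_vec d" and w: "decomposable (H *\<^sub>v v - a \<cdot>\<^sub>v v)"
  shows "decomposable v"
proof -
  obtain g where g: "\<And>b. g b \<in> eigenspace H b" "H *\<^sub>v v - a \<cdot>\<^sub>v v = vec_sum d Spec g"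
    using w unfolding decomposable_def by blast
  have gc: "g b \<in> carrier_vec d" for b using g(1) by auto
  define s where "s = vec_sum d (Spec - {a}) (\<lambda>b. (1 / (b - a)) \<cdot>\<^sub>v g b)"
  have sc: "s \<in> carrier_vec d" by (simp add: s_def)
  have s: "decomposable s"
    unfolding s_def
  proof (rule decomposable_vec_sum)
    fix b assume "b \<in> Spec - {a}"
    hence "g b = vec_sum d Spec (\<lambda>x. if x = b then g b else 0\<^sub>v d)"
      using finite_Spec gc[of b] by (intro eq_vecI) (auto simp: if_distrib[of "\<lambda>v. v $ _"] sum.delta' cong: if_cong)
    hence "decomposable (g b)"
      unfolding decomposable_def using g(1)
      by (intro exI[of _ "\<lambda>x. if x = b then g b else 0\<^sub>v d"]) auto
    thus "decomposable ((1 / (b - a)) \<cdot>\<^sub>v g b)" by (rule decomposable_smult)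
  qed (use finite_Spec gc in auto)
  define u where "u = v - s"
  have uc: "u \<in> carrier_vec d" using v sc by (simp add: u_def)
  have Hs: "H *\<^sub>v s = vec_sum d (Spec - {a}) (\<lambda>b. (b / (b - a)) \<cdot>\<^sub>v g b)"
    unfolding s_def using gc eigenspaceD(2)[OF g(1)]
    by (subst mult_mat_vec_sum[OF H_carrier])
       (auto simp: mult_mat_vec[OF H_carrier gc] smult_smult_assoc intro!: eq_vecI sum.cong)
  \<comment> \<open>\<open>H - a\<close> sends \<open>g b / (b - a)\<close> to \<open>g b\<close>,
    so every component of \<open>(H - a) v\<close> other than the \<open>a\<close>-component
    cancels; that one occurs only if \<open>a\<close> is an eigenvalue.\<close>
  have "H *\<^sub>v u - a \<cdot>\<^sub>v u = (if a \<in> Spec then g a else 0\<^sub>v d)"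
  proof (rule eq_vecI)
    fix i assume "i < dim_vec (if a \<in> Spec then g a else 0\<^sub>v d)"
    hence i: "i < d" using gc[of a] by (auto split: if_splits)
    have gd: "dim_vec (g b) = d" for b using gc carrier_vecD by blast
    have "(H *\<^sub>v u - a \<cdot>\<^sub>v u) $ i = (H *\<^sub>v v - a \<cdot>\<^sub>v v) $ i - ((H *\<^sub>v s) $ i - a * s $ i)"
      unfolding u_def using i v sc
      by (subst mult_minus_distrib_mat_vec[OF H_carrier v sc])
         (simp add: algebra_simps del: index_mult_mat_vec)
    also have "(H *\<^sub>v s) $ i - a * s $ i = (\<Sum>b\<in>Spec - {a}. g b $ i)"
      unfolding Hs using i gc carrier_vecD[OF gc]
      by (simp add: s_def sum_distrib_left sum_subtractf[symmetric])
         (intro sum.cong refl, auto simp: gd divide_simps, simp add: algebra_simps)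
    also have "(H *\<^sub>v v - a \<cdot>\<^sub>v v) $ i = (\<Sum>b\<in>Spec. g b $ i)" using i by (simp add: g(2))
    also have "(\<Sum>b\<in>Spec. g b $ i) - (\<Sum>b\<in>Spec - {a}. g b $ i) = (if a \<in> Spec then g a $ i else 0)"
      using finite_Spec by (simp add: sum_diff1)
    finally show "(H *\<^sub>v u - a \<cdot>\<^sub>v u) $ i = (if a \<in> Spec then g a else 0\<^sub>v d) $ i"
      using i by simp
  qed (use uc gc[of a] in \<open>auto dest: carrier_vecD\<close>)
  also have "\<dots> \<in> eigenspace H a" using g(1) by simp
  finally have "H *\<^sub>v u = a \<cdot>\<^sub>v u" by (rule no_jordan_block[OF uc])
  hence u: "u \<in> eigenspace H a" using uc by (intro eigenspaceI)
  have "decomposable u"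
  proof (cases "a \<in> Spec")
    case True
    hence "u = vec_sum d Spec (\<lambda>x. if x = a then u else 0\<^sub>v d)"
      using finite_Spec uc by (intro eq_vecI) (auto simp: if_distrib[of "\<lambda>v. v $ _"] sum.delta' cong: if_cong)
    thus ?thesis unfolding decomposable_def using u
      by (intro exI[of _ "\<lambda>x. if x = a then u else 0\<^sub>v d"]) auto
  next
    case False
    thus ?thesis using eigenspace_trivial[OF u] decomposable_zero by simp
  qed
  moreover have "v = u + s" using v sc by (auto simp: u_def intro!: eq_vecI)
  ultimately show ?thesis using s decomposable_add by simp
qed

text \<open>Schur triangularization gives \<open>H P = P B\<close> with \<open>B\<close> upper
  triangular, so \<open>H - B $$ (j, j)\<close> maps column \<open>j\<close> of \<open>P\<close>
  into the span of the earlier columns. Strong induction with \<open>decomposable_step\<close>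
  decomposes every column, and the columns span because \<open>P\<close> is invertible.\<close>

lemma decomposable:
  assumes "v \<in> carrier_vec d" shows "decomposable v"
proof -
  obtain as where "char_poly H = (\<Prod>a\<leftarrow>as. [:- a, 1:])"
    using char_poly_factorized[OF H_carrier] by blast
  then obtain B where "upper_triangular B" "similar_mat H B"
    using schur_decomposition_exists[OF H_carrier] by blast
  then obtain P Q where ut: "upper_triangular B" and wit: "similar_mat_wit H B P Q"
    unfolding similar_mat_def by blast
  note w = similar_mat_witD2[OF H_carrier wit]
  have Bc: "B \<in> carrier_mat d d" and Pc: "P \<in> carrier_mat d d" and Qc: "Q \<in> carrier_mat d d"
    using w by auto
  have HP: "H * P = P * B"
  proof -
    have "H * P = P * B * (Q * P)"
      using w(3) assoc_mult_mat[OF mult_carrier_mat[OF Pc Bc] Qc Pc] by simp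
    thus ?thesis using w(2) right_mult_one_mat[OF mult_carrier_mat[OF Pc Bc]] by simp
  qed
  have col: "decomposable (col P j)" if "j < d" for j
    using that
  proof (induction j rule: less_induct)
    case (less j)
    have "H *\<^sub>v col P j - B $$ (j, j) \<cdot>\<^sub>v col P j = vec_sum d {..<j} (\<lambda>i. B $$ (i, j) \<cdot>\<^sub>v col P i)"
    proof (rule eq_vecI)
      fix r assume "r < dim_vec (vec_sum d {..<j} (\<lambda>i. B $$ (i, j) \<cdot>\<^sub>v col P i))"
      hence r: "r < d" by simp
      have "(H *\<^sub>v col P j) $ r = (H * P) $$ (r, j)"
        using r less.prems Pc by simp
      also have "\<dots> = (\<Sum>i<d. P $$ (r, i) * B $$ (i, j))"
        unfolding HP using r less.prems Pc Bc by (simp add: scalar_prod_def atLeast0LessThan)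
      \<comment> \<open>Entries of \<open>B\<close> below the diagonal vanish; the term
        \<open>i = j\<close> is the one subtracted on the left-hand side of the claim.\<close>
      also have "\<dots> = (\<Sum>i<Suc j. P $$ (r, i) * B $$ (i, j))"
        using ut Bc less.prems
        by (intro sum.mono_neutral_right) (auto simp: upper_triangular_def not_less_eq)
      finally have "(H *\<^sub>v col P j) $ r = (\<Sum>i<Suc j. P $$ (r, i) * B $$ (i, j))" .
      thus "(H *\<^sub>v col P j - B $$ (j, j) \<cdot>\<^sub>v col P j) $ r
          = vec_sum d {..<j} (\<lambda>i. B $$ (i, j) \<cdot>\<^sub>v col P i) $ r"
        using r less.prems Pc by (simp add: mult.commute del: index_mult_mat_vec)
    qed (use Pc in auto)
    moreover have "decomposable (vec_sum d {..<j} (\<lambda>i. B $$ (i, j) \<cdot>\<^sub>v col P i))"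
      using less Pc by (intro decomposable_vec_sum decomposable_smult) auto
    ultimately have "decomposable (H *\<^sub>v col P j - B $$ (j, j) \<cdot>\<^sub>v col P j)" by simp
    thus ?case by (rule decomposable_step[rotated]) (use Pc in auto)
  qed
  have Qv: "Q *\<^sub>v v \<in> carrier_vec d" using Qc assms by simp
  have "v = P * Q *\<^sub>v v"
    unfolding w(1) using assms by simp
  also have "\<dots> = P *\<^sub>v (Q *\<^sub>v v)"
    by (rule assoc_mult_mat_vec[OF Pc Qc assms])
  also have "\<dots> = vec_sum d {..<d} (\<lambda>j. (Q *\<^sub>v v) $ j \<cdot>\<^sub>v col P j)"
    using Pc Qv by (intro eq_vecI) (auto simp: scalar_prod_def atLeast0LessThan mult.commute simp del: index_mult_mat_vec simp: mult_mat_vec_index[OF Pc Qv])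
  also have "decomposable \<dots>"
    using col Pc by (intro decomposable_vec_sum decomposable_smult) auto
  finally show ?thesis .
qed

end

section \<open>Spectral projectors and their uniqueness\<close>

lemma mat_index_unit_vec:
  fixes A :: "complex mat"
  assumes "A \<in> carrier_mat n m" "i < n" "j < m"
  shows "A $$ (i, j) = (A *\<^sub>v unit_vec m j) $ i"
proof -
  have "(A *\<^sub>v unit_vec m j) $ i = (\<Sum>k<m. if k = j then A $$ (i, k) else 0)"
    using assms unfolding mult_mat_vec_index[OF assms(1) unit_vec_carrier assms(2)]
    by (intro sum.cong) auto
  thus ?thesis using assms by simp
qed

lemma mat_eq_if_mult_vec_eq:
  fixes A B :: "complex mat"
  assumes A: "A \<in> carrier_mat n m" and B: "B \<in> carrier_mat n m"
    and "\<And>v. v \<in> carrier_vec m \<Longrightarrow> A *\<^sub>v v = B *\<^sub>v v"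
  shows "A = B"
proof (rule eq_matI)
  fix i j assume "i < dim_row B" "j < dim_col B"
  hence ij: "i < n" "j < m" using B by auto
  thus "A $$ (i, j) = B $$ (i, j)"
    using assms(3)[of "unit_vec m j"] by (simp add: mat_index_unit_vec[OF A] mat_index_unit_vec[OF B] del: index_mult_mat_vec)
qed (use A B in auto)

lemma cscalar_unit_vec:
  fixes x :: "complex vec"
  assumes "x \<in> carrier_vec d" "i < d"
  shows "x \<bullet>c unit_vec d i = x $ i"
proof -
  have "x \<bullet>c unit_vec d i = (\<Sum>k<d. if k = i then x $ k else 0)"
    unfolding cscalar_eq_sum using assms by (intro sum.cong) auto
  thus ?thesis using assms by simp
qed

context hermitian
begin

lemma eigenspace_vec_sum:
  assumes "\<And>a. a \<in> S \<Longrightarrow> g a \<in> eigenspace H E"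
  shows "vec_sum d S g \<in> eigenspace H E"
proof (rule eigenspaceI)
  have "H *\<^sub>v vec_sum d S g = vec_sum d S (\<lambda>a. H *\<^sub>v g a)"
    using assms by (intro mult_mat_vec_sum[OF H_carrier]) auto
  also have "\<dots> = E \<cdot>\<^sub>v vec_sum d S g"
  proof (rule eq_vecI)
    fix i assume "i < dim_vec (E \<cdot>\<^sub>v vec_sum d S g)"
    hence i: "i < d" by simp
    have "(H *\<^sub>v g a) $ i = E * g a $ i" if "a \<in> S" for a
      using eigenspaceD[OF assms[OF that]] i by (simp del: index_mult_mat_vec)
    thus "vec_sum d S (\<lambda>a. H *\<^sub>v g a) $ i = (E \<cdot>\<^sub>v vec_sum d S g) $ i"
      using i by (simp add: sum_distrib_left del: index_mult_mat_vec)
  qed simp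
  finally show "H *\<^sub>v vec_sum d S g = E \<cdot>\<^sub>v vec_sum d S g" .
qed simp

text \<open>Only basis vectors are decomposed by choice. \<open>proj E\<close> takes these
  components as its columns and is thus linear by construction, which a separate choice for every
  vector would not guarantee.\<close>

definition unit_comp :: "nat \<Rightarrow> complex \<Rightarrow> complex vec" where
  "unit_comp j = (SOME g. (\<forall>a. g a \<in> eigenspace H a) \<and> unit_vec d j = vec_sum d Spec g)"

lemma unit_comp: "unit_comp j a \<in> eigenspace H a" "unit_vec d j = vec_sum d Spec (unit_comp j)"
proof -
  have "\<exists>g. (\<forall>a. g a \<in> eigenspace H a) \<and> unit_vec d j = vec_sum d Spec g"
    using decomposable[of "unit_vec d j"] by (simp add: decomposable_def)
  from someI_ex[OF this]
  show "unit_comp j a \<in> eigenspace H a" "unit_vec d j = vec_sum d Spec (unit_comp j)"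
    by (auto simp: unit_comp_def)
qed

definition proj :: "complex \<Rightarrow> complex mat" where
  "proj E = mat d d (\<lambda>(i, j). unit_comp j E $ i)"

lemma proj_carrier [simp]: "proj E \<in> carrier_mat d d"
  by (simp add: proj_def)

lemma mult_proj_carrier [simp]: "v \<in> carrier_vec d \<Longrightarrow> proj E *\<^sub>v v \<in> carrier_vec d"
  by (rule mult_mat_vec_carrier[OF proj_carrier])

lemma proj_eigenspace:
  assumes v: "v \<in> carrier_vec d" shows "proj E *\<^sub>v v \<in> eigenspace H E"
proof -
  have dim: "dim_vec (unit_comp j E) = d" for j
    using eigenspaceD(1)[OF unit_comp(1)] by auto
  have "proj E *\<^sub>v v = vec_sum d {..<d} (\<lambda>j. v $ j \<cdot>\<^sub>v unit_comp j E)"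
  proof (rule eq_vecI)
    fix i assume "i < dim_vec (vec_sum d {..<d} (\<lambda>j. v $ j \<cdot>\<^sub>v unit_comp j E))"
    hence i: "i < d" by simp
    show "(proj E *\<^sub>v v) $ i = vec_sum d {..<d} (\<lambda>j. v $ j \<cdot>\<^sub>v unit_comp j E) $ i"
      unfolding mult_mat_vec_index[OF proj_carrier v i] using i by (simp add: proj_def dim mult.commute)
  qed (simp add: proj_def)
  thus ?thesis by (simp add: eigenspace_vec_sum eigenspace_smult unit_comp(1))
qed

lemma proj_resolution:
  assumes v: "v \<in> carrier_vec d" shows "v = vec_sum d Spec (\<lambda>E. proj E *\<^sub>v v)"
proof (rule eq_vecI)
  fix i assume "i < dim_vec (vec_sum d Spec (\<lambda>E. proj E *\<^sub>v v))"
  hence i: "i < d" by simp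
  have "vec_sum d Spec (\<lambda>E. proj E *\<^sub>v v) $ i = (\<Sum>E\<in>Spec. \<Sum>j<d. unit_comp j E $ i * v $ j)"
    using i by (simp add: mult_mat_vec_index[OF proj_carrier v i] del: index_mult_mat_vec) (simp add: proj_def)
  also have "\<dots> = (\<Sum>j<d. \<Sum>E\<in>Spec. unit_comp j E $ i * v $ j)" by (rule sum.swap)
  also have "\<dots> = (\<Sum>j<d. unit_vec d j $ i * v $ j)"
    by (intro sum.cong refl, subst unit_comp(2)) (simp add: i sum_distrib_right)
  also have "\<dots> = (\<Sum>j<d. if j = i then v $ j else 0)"
    using i by (intro sum.cong) auto
  also have "\<dots> = v $ i" using i by simp
  finally show "v $ i = vec_sum d Spec (\<lambda>E. proj E *\<^sub>v v) $ i" by simp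
qed (use v in auto)

text \<open>Pairing the resolution of \<open>v\<close> with \<open>u\<close> kills all components of
  energy other than \<open>E\<close>. By \<open>eigenspace_eqI\<close> this determines
  \<open>proj E v\<close>, whatever choices were made in \<open>unit_comp\<close>; idempotence,
  self-adjointness and uniqueness all follow from it.\<close>

lemma proj_cscalar_eigenspace:
  assumes v: "v \<in> carrier_vec d" and u: "u \<in> eigenspace H E"
  shows "(proj E *\<^sub>v v) \<bullet>c u = v \<bullet>c u"
proof (cases "E \<in> Spec")
  case True
  have uc: "u \<in> carrier_vec d" using u by auto
  have "v \<bullet>c u = (\<Sum>F\<in>Spec. (proj F *\<^sub>v v) \<bullet>c u)"
    by (subst proj_resolution[OF v]) (rule cscalar_vec_sum_left[OF uc])
  also have "\<dots> = (\<Sum>F\<in>Spec. if F = E then (proj F *\<^sub>v v) \<bullet>c u else 0)"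
    using eigenspace_orthogonal[OF proj_eigenspace[OF v] u] by (intro sum.cong) auto
  also have "\<dots> = (proj E *\<^sub>v v) \<bullet>c u" using True finite_Spec by simp
  finally show ?thesis by simp
next
  case False
  hence "u = 0\<^sub>v d" by (rule eigenspace_trivial[OF u])
  thus ?thesis using v by (simp add: cscalar_eq_sum)
qed

text \<open>The difference \<open>x - y\<close> lies in the same eigenspace and may itself serve as
  the test vector \<open>u\<close>.\<close>

lemma eigenspace_eqI:
  assumes "x \<in> eigenspace H E" "y \<in> eigenspace H E" "\<And>u. u \<in> eigenspace H E \<Longrightarrow> x \<bullet>c u = y \<bullet>c u"
  shows "x = y"
proof -
  have xy: "x - y \<in> eigenspace H E" using assms by (simp add: eigenspace_diff)
  have c: "x \<in> carrier_vec d" "y \<in> carrier_vec d" "x - y \<in> carrier_vec d" using assms(1,2) xy by auto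
  have "(x - y) \<bullet>c (x - y) = 0"
    using cscalar_diff_left[OF c] assms(3)[OF xy] by simp
  hence z: "x - y = 0\<^sub>v d" using c by simp
  show ?thesis
  proof (rule eq_vecI)
    fix i assume "i < dim_vec y"
    thus "x $ i = y $ i" using arg_cong[OF z, of "\<lambda>v. v $ i"] c by simp
  qed (use c in auto)
qed

lemma proj_fixes:
  assumes u: "u \<in> eigenspace H E" shows "proj E *\<^sub>v u = u"
  using u by (intro eigenspace_eqI[of _ E] proj_eigenspace proj_cscalar_eigenspace) auto

text \<open>Both sides equal the inner product of \<open>proj E x\<close> with
  \<open>proj E y\<close>.\<close>

lemma proj_swap:
  assumes x: "x \<in> carrier_vec d" and y: "y \<in> carrier_vec d"
  shows "(proj E *\<^sub>v x) \<bullet>c y = x \<bullet>c (proj E *\<^sub>v y)"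
proof -
  have "(proj E *\<^sub>v x) \<bullet>c y = cnj (y \<bullet>c (proj E *\<^sub>v x))"
    using x y by (subst cscalar_cnj) (auto simp: proj_def)
  also have "\<dots> = cnj ((proj E *\<^sub>v y) \<bullet>c (proj E *\<^sub>v x))"
    by (simp add: proj_cscalar_eigenspace[OF y proj_eigenspace[OF x]])
  also have "\<dots> = (proj E *\<^sub>v x) \<bullet>c (proj E *\<^sub>v y)"
    using x y by (subst cscalar_cnj) (auto simp: proj_def)
  finally show ?thesis by (simp add: proj_cscalar_eigenspace[OF x proj_eigenspace[OF y]])
qed

lemma mat_adjoint_proj: "mat_adjoint (proj E) = proj E"
proof (rule eq_matI)
  fix i j assume "i < dim_row (proj E)" "j < dim_col (proj E)"
  hence ij: "i < d" "j < d" by (auto simp: proj_def)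
  have entry: "proj E $$ (i, j) = (proj E *\<^sub>v unit_vec d j) \<bullet>c unit_vec d i" if "i < d" "j < d" for i j
    using that by (simp add: cscalar_unit_vec mat_index_unit_vec[OF proj_carrier that] del: index_mult_mat_vec)
  have "cnj (proj E $$ (j, i)) = unit_vec d j \<bullet>c (proj E *\<^sub>v unit_vec d i)"
    unfolding entry[OF ij(2,1)] by (subst cscalar_cnj) (auto simp: proj_def)
  also have "\<dots> = proj E $$ (i, j)"
    unfolding entry[OF ij] by (rule proj_swap[symmetric]) auto
  finally show "mat_adjoint (proj E) $$ (i, j) = proj E $$ (i, j)"
    by (simp add: mat_adjoint_index[OF proj_carrier ij])
qed (use mat_adjoint_carrier[OF proj_carrier] in \<open>auto simp: proj_def mat_adjoint_def\<close>)

lemma eigenprojector_eq: "eigenprojector H E = proj E"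
  unfolding eigenprojector_def dim_H
proof (rule the_equality, intro conjI)
  show "proj E * proj E = proj E"
    by (rule mat_eq_if_mult_vec_eq[of _ d d])
       (auto simp: assoc_mult_mat_vec[OF proj_carrier proj_carrier] mult_carrier_mat[OF proj_carrier proj_carrier]
         intro!: proj_fixes proj_eigenspace)
  show "(\<lambda>v. proj E *\<^sub>v v) ` carrier_vec d = {v \<in> carrier_vec d. H *\<^sub>v v = E \<cdot>\<^sub>v v}"
  proof -
    have "u \<in> (\<lambda>v. proj E *\<^sub>v v) ` carrier_vec d" if "u \<in> eigenspace H E" for u
      using proj_fixes[OF that] that by (metis eigenspaceD(1) image_eqI)
    hence "(\<lambda>v. proj E *\<^sub>v v) ` carrier_vec d = eigenspace H E"
      using proj_eigenspace by blast
    thus ?thesis by (simp add: eigenspace_def)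
  qed
next
  \<comment> \<open>Uniqueness: a vector \<open>u\<close> in the range is fixed by the idempotent
    \<open>Q\<close>, so \<open>Q v\<close> paired with \<open>u\<close> equals \<open>v\<close>
    paired with \<open>Q u = u\<close>, the same value as for \<open>proj E\<close>.\<close>
  fix Q assume Q: "Q \<in> carrier_mat d d \<and> mat_adjoint Q = Q \<and> Q * Q = Q \<and>
    (\<lambda>v. Q *\<^sub>v v) ` carrier_vec d = {v \<in> carrier_vec d. H *\<^sub>v v = E \<cdot>\<^sub>v v}"
  hence Qc: "Q \<in> carrier_mat d d" and QQ: "Q * Q = Q" and adj: "mat_adjoint Q = Q"
    and range: "(\<lambda>v. Q *\<^sub>v v) ` carrier_vec d = eigenspace H E"
    by (auto simp: eigenspace_def)
  show "Q = proj E"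
  proof (rule mat_eq_if_mult_vec_eq[OF Qc proj_carrier])
    fix v :: "complex vec" assume v: "v \<in> carrier_vec d"
    show "Q *\<^sub>v v = proj E *\<^sub>v v"
    proof (rule eigenspace_eqI)
      show "Q *\<^sub>v v \<in> eigenspace H E" using range v by blast
      show "proj E *\<^sub>v v \<in> eigenspace H E" by (rule proj_eigenspace[OF v])
      fix u assume u: "u \<in> eigenspace H E"
      hence uc: "u \<in> carrier_vec d" by auto
      obtain x where x: "x \<in> carrier_vec d" "u = Q *\<^sub>v x" using u range by blast
      have "Q *\<^sub>v u = u"
        using assoc_mult_mat_vec[OF Qc Qc x(1)] by (simp add: x(2) QQ)
      thus "(Q *\<^sub>v v) \<bullet>c u = (proj E *\<^sub>v v) \<bullet>c u"
        using cscalar_adjoint[OF Qc v uc] proj_cscalar_eigenspace[OF v u] by (simp add: adj)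
    qed
  qed
qed (simp_all add: mat_adjoint_proj)

section \<open>Matrix exponential, time evolution and outcome probabilities\<close>

lemma pow_eigenspace:
  assumes "u \<in> eigenspace H E"
  shows "((c \<cdot>\<^sub>m H) ^\<^sub>m k) *\<^sub>v u = (c * E) ^ k \<cdot>\<^sub>v u"
proof (induction k)
  case 0
  have u: "u \<in> carrier_vec d" using assms by auto
  have "(c \<cdot>\<^sub>m H) ^\<^sub>m 0 = 1\<^sub>m d" by simp
  thus ?case using u by (simp only: one_mult_mat_vec power_0) (auto intro!: eq_vecI)
next
  case (Suc k)
  have u: "u \<in> carrier_vec d" using assms by auto
  have A: "c \<cdot>\<^sub>m H \<in> carrier_mat d d" and Ak: "(c \<cdot>\<^sub>m H) ^\<^sub>m k \<in> carrier_mat d d" by auto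
  have "(c \<cdot>\<^sub>m H) *\<^sub>v u = c \<cdot>\<^sub>v (H *\<^sub>v u)"
    using u by (intro eq_vecI) (auto simp: scalar_prod_def sum_distrib_left mult.assoc)
  also have "\<dots> = (c * E) \<cdot>\<^sub>v u"
    using eigenspaceD(2)[OF assms] by (simp add: smult_smult_assoc)
  finally have Au: "(c \<cdot>\<^sub>m H) *\<^sub>v u = (c * E) \<cdot>\<^sub>v u" .
  have "((c \<cdot>\<^sub>m H) ^\<^sub>m Suc k) *\<^sub>v u = (c \<cdot>\<^sub>m H) ^\<^sub>m k *\<^sub>v ((c \<cdot>\<^sub>m H) *\<^sub>v u)"
    unfolding pow_mat.simps by (rule assoc_mult_mat_vec[OF Ak A u])
  also have "\<dots> = (c * E) \<cdot>\<^sub>v ((c * E) ^ k \<cdot>\<^sub>v u)"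
    unfolding Au mult_mat_vec[OF Ak u] Suc.IH ..
  finally show ?case by (simp add: smult_smult_assoc)
qed

text \<open>Column \<open>j\<close> of a power of \<open>c H\<close> is that power applied to a
  basis vector. On each energy component of the basis vector it acts as the scalar
  \<open>(c * E) ^ k\<close>, so the entrywise series is a finite combination of scalar exponential
  series.\<close>

lemma mat_exp_index:
  assumes ij: "i < d" "j < d"
  shows "mat_exp (c \<cdot>\<^sub>m H) $$ (i, j) = (\<Sum>E\<in>Spec. exp (c * E) * proj E $$ (i, j))"
proof -
  have pow: "((c \<cdot>\<^sub>m H) ^\<^sub>m k) $$ (i, j) = (\<Sum>E\<in>Spec. (c * E) ^ k * proj E $$ (i, j))" for k
  proof -
    have Ak: "(c \<cdot>\<^sub>m H) ^\<^sub>m k \<in> carrier_mat d d" by auto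
    have "((c \<cdot>\<^sub>m H) ^\<^sub>m k) $$ (i, j) = (((c \<cdot>\<^sub>m H) ^\<^sub>m k) *\<^sub>v vec_sum d Spec (\<lambda>E. proj E *\<^sub>v unit_vec d j)) $ i"
      by (subst proj_resolution[symmetric]) (auto simp: mat_index_unit_vec[OF Ak ij] simp del: index_mult_mat_vec)
    also have "\<dots> = (\<Sum>E\<in>Spec. (((c \<cdot>\<^sub>m H) ^\<^sub>m k) *\<^sub>v (proj E *\<^sub>v unit_vec d j)) $ i)"
      by (subst mult_mat_vec_sum[OF Ak]) (auto simp: ij simp del: index_mult_mat_vec)
    also have "\<dots> = (\<Sum>E\<in>Spec. (c * E) ^ k * proj E $$ (i, j))"
    proof (rule sum.cong[OF refl])
      fix E
      have "dim_vec (proj E *\<^sub>v unit_vec d j) = d" by (simp add: proj_def)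
      thus "(((c \<cdot>\<^sub>m H) ^\<^sub>m k) *\<^sub>v (proj E *\<^sub>v unit_vec d j)) $ i = (c * E) ^ k * proj E $$ (i, j)"
        unfolding pow_eigenspace[OF proj_eigenspace[OF unit_vec_carrier]] mat_index_unit_vec[OF proj_carrier ij]
        using ij by (simp del: index_mult_mat_vec)
    qed
    finally show ?thesis .
  qed
  have "(\<lambda>k. (c * E) ^ k / fact k * proj E $$ (i, j)) sums (exp (c * E) * proj E $$ (i, j))" for E
    using exp_converges[of "c * E"] by (intro sums_mult2) (simp add: scaleR_conv_of_real field_simps)
  hence "(\<lambda>k. \<Sum>E\<in>Spec. (c * E) ^ k / fact k * proj E $$ (i, j))
      sums (\<Sum>E\<in>Spec. exp (c * E) * proj E $$ (i, j))"
    by (intro sums_sum)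
  hence "(\<Sum>k. ((c \<cdot>\<^sub>m H) ^\<^sub>m k) $$ (i, j) / fact k) = (\<Sum>E\<in>Spec. exp (c * E) * proj E $$ (i, j))"
    by (simp add: pow sum_divide_distrib sums_iff)
  thus ?thesis using ij by (simp add: mat_exp_def)
qed

lemma evolved_carrier:
  assumes "\<psi> \<in> carrier_vec d" shows "evolved H \<psi> t \<in> carrier_vec d"
  unfolding evolved_def
  by (rule mult_mat_vec_carrier[of _ d d]) (use assms in \<open>auto simp: mat_exp_def\<close>)

lemma evolved_index:
  assumes v: "\<psi> \<in> carrier_vec d" and i: "i < d"
  shows "evolved H \<psi> t $ i = (\<Sum>E\<in>Spec. exp (- \<i> * t * E) * (proj E *\<^sub>v \<psi>) $ i)"
proof -
  define c where "c = - \<i> * complex_of_real t"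
  have "mat_exp (c \<cdot>\<^sub>m H) \<in> carrier_mat d d" by (simp add: mat_exp_def)
  hence "evolved H \<psi> t $ i = (\<Sum>j<d. \<Sum>E\<in>Spec. exp (c * E) * proj E $$ (i, j) * \<psi> $ j)"
    unfolding evolved_def c_def[symmetric]
    by (simp add: mult_mat_vec_index[OF _ v i] mat_exp_index i sum_distrib_right del: index_mult_mat_vec)
  also have "\<dots> = (\<Sum>E\<in>Spec. \<Sum>j<d. exp (c * E) * proj E $$ (i, j) * \<psi> $ j)" by (rule sum.swap)
  also have "\<dots> = (\<Sum>E\<in>Spec. exp (c * E) * (proj E *\<^sub>v \<psi>) $ i)"
    by (simp add: mult_mat_vec_index[OF proj_carrier v i] sum_distrib_left mult.assoc del: index_mult_mat_vec)
  finally show ?thesis by (simp add: c_def)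
qed

text \<open>The projector is self-adjoint and idempotent, so the squared norm equals
  \<open>proj E \<psi>\<close> paired with \<psi>. That number is therefore already real, and the
  real part in \<open>outcome_prob\<close> loses nothing.\<close>

lemma proj_norm:
  assumes v: "\<psi> \<in> carrier_vec d"
  shows "(proj E *\<^sub>v \<psi>) \<bullet>c (proj E *\<^sub>v \<psi>) = outcome_prob H \<psi> E"
proof -
  have "(proj E *\<^sub>v \<psi>) \<bullet>c (proj E *\<^sub>v \<psi>) = (proj E *\<^sub>v \<psi>) \<bullet>c \<psi>"
    using proj_swap[of "\<psi>" "proj E *\<^sub>v \<psi>"] proj_fixes[OF proj_eigenspace[OF v]] proj_swap[OF v v] v by simp
  moreover have "Re z = z" if "z = complex_of_real r" for z r using that by simp
  ultimately show ?thesis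
    unfolding outcome_prob_def eigenprojector_eq using cscalar_self by metis
qed

lemma outcome_prob_eq_0: 
  assumes v: "\<psi> \<in> carrier_vec d"
  shows "outcome_prob H \<psi> E = 0 \<longleftrightarrow> proj E *\<^sub>v \<psi> = 0\<^sub>v d"
  using conjugate_square_eq_0_vec[OF mult_proj_carrier[OF v], of E] unfolding proj_norm[OF v] by simp

end

text \<open>The interface between the spectral theory and the process: orthogonal, time-independent
  components weighted by the outcome probabilities, with time entering only through exponentials of
  real energies. The sums run over the support alone because the component \<open>g E\<close>
  vanishes for the other eigenvalues.\<close>

theorem energy_decomposition:
  assumes "hermitian_mat d H" "\<psi> \<in> carrier_vec d" "\<psi> \<bullet>c \<psi> = 1"
  obtains g :: "complex \<Rightarrow> complex vec" where "\<And>E. g E \<in> carrier_vec d"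
    "finite (energy_support H \<psi>)" "energy_support H \<psi> \<subseteq> \<real>"
    "\<And>E. E \<in> energy_support H \<psi> \<Longrightarrow> outcome_prob H \<psi> E > 0"
    "(\<Sum>E\<in>energy_support H \<psi>. outcome_prob H \<psi> E) = 1"
    "\<And>E F. E \<noteq> F \<Longrightarrow> g E \<bullet>c g F = 0"
    "\<And>E. g E \<bullet>c g E = complex_of_real (outcome_prob H \<psi> E)"
    "\<And>t. evolved H \<psi> t \<in> carrier_vec d"
    "\<And>t i. i < d \<Longrightarrow> evolved H \<psi> t $ i = (\<Sum>E\<in>energy_support H \<psi>. exp (- \<i> * t * E) * g E $ i)"
proof -
  interpret hermitian d H by unfold_locales fact
  note v = assms(2)
  let ?S = "energy_support H \<psi>"
  define g where "g E = proj E *\<^sub>v \<psi>" for E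
  have eig: "g E \<in> eigenspace H E" for E by (simp add: g_def proj_eigenspace v)
  have S: "?S = {E \<in> Spec. g E \<noteq> 0\<^sub>v d}"
    by (auto simp: energy_support_def g_def outcome_prob_eq_0[OF v])
  have nonneg: "outcome_prob H \<psi> E \<ge> 0" for E
  proof -
    have "complex_of_real (outcome_prob H \<psi> E) \<ge> 0"
      unfolding proj_norm[OF v, symmetric] by (rule conjugate_square_ge_0_vec)
    thus ?thesis by (simp add: less_eq_complex_def)
  qed
  show ?thesis
  proof (rule that[of g])
    show "g E \<in> carrier_vec d" for E using eig by auto
    show "finite ?S" using finite_Spec by (simp add: S)
    show "?S \<subseteq> \<real>"
      using eigenspace_real[OF eig] by (auto simp: S Reals_cnj_iff)
    show "outcome_prob H \<psi> E > 0" if "E \<in> ?S" for E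
      using that nonneg[of E] by (simp add: energy_support_def)
    show "g E \<bullet>c g F = 0" if "E \<noteq> F" for E F by (rule eigenspace_orthogonal[OF eig eig that])
    show gg: "g E \<bullet>c g E = complex_of_real (outcome_prob H \<psi> E)" for E by (simp add: g_def proj_norm v)
    show "evolved H \<psi> t \<in> carrier_vec d" for t by (rule evolved_carrier[OF v])
    have "vec_sum d Spec g \<bullet>c \<psi> = 1"
      using assms(3) proj_resolution[OF v] unfolding g_def by metis
    hence "1 = (\<Sum>E\<in>Spec. g E \<bullet>c \<psi>)"
      by (simp only: cscalar_vec_sum_left[OF v])
    also have "\<dots> = (\<Sum>E\<in>Spec. complex_of_real (outcome_prob H \<psi> E))"
    proof (rule sum.cong[OF refl])
      fix E
      have "g E \<bullet>c \<psi> = \<psi> \<bullet>c g E" unfolding g_def using proj_swap v by simp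
      thus "g E \<bullet>c \<psi> = outcome_prob H \<psi> E"
        using proj_cscalar_eigenspace[OF v eig[of E]] gg by (simp add: g_def)
    qed
    also have "\<dots> = of_real (\<Sum>E\<in>?S. outcome_prob H \<psi> E)"
      unfolding of_real_sum using finite_Spec
      by (intro sum.mono_neutral_right) (auto simp: energy_support_def)
    finally show "(\<Sum>E\<in>?S. outcome_prob H \<psi> E) = 1" by (metis of_real_eq_1_iff)
    show "evolved H \<psi> t $ i = (\<Sum>E\<in>?S. exp (- \<i> * t * E) * g E $ i)" if i: "i < d" for t i
      unfolding evolved_index[OF v i] g_def[symmetric] using finite_Spec i
      by (intro sum.mono_neutral_right) (auto simp: S)
  qed
qed

lemma mod_mult_less: "i mod n < n" if "i < m * n" for i m n :: nat
  using that by (cases "n = 0") auto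

lemma mult_add_less:
  fixes a b m n :: nat
  assumes "a < m" "b < n" shows "a * n + b < m * n"
proof -
  have "a * n + b < Suc a * n" using assms by simp
  also have "\<dots> \<le> m * n" using assms by (intro mult_right_mono) auto
  finally show ?thesis .
qed

lemma sum_lessThan_mult:
  fixes f :: "nat \<Rightarrow> 'a::comm_monoid_add"
  shows "(\<Sum>i<m * n. f i) = (\<Sum>a<m. \<Sum>b<n. f (a * n + b))"
proof -
  have "(\<Sum>i<m * n. f i) = (\<Sum>(a, b)\<in>{..<m} \<times> {..<n}. f (a * n + b))"
    by (rule sum.reindex_bij_witness[where i = "\<lambda>(a, b). a * n + b" and j = "\<lambda>i. (i div n, i mod n)"])
     (auto simp: less_mult_imp_div_less mod_mult_less mult_add_less)
  thus ?thesis by (simp add: sum.cartesian_product)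
qed

subsection \<open>Tensor products\<close>

lemma kron_vec_carrier:
  "v \<in> carrier_vec m \<Longrightarrow> w \<in> carrier_vec n \<Longrightarrow> kron_vec v w \<in> carrier_vec (m * n)"
  by (auto simp: kron_vec_def intro!: carrier_vecI)

lemma kron_vec_index:
  assumes "v \<in> carrier_vec m" "w \<in> carrier_vec n" "i < m * n"
  shows "kron_vec v w $ i = v $ (i div n) * w $ (i mod n)"
  using assms by (simp add: kron_vec_def)

lemma cscalar_kron_vec:
  assumes "v \<in> carrier_vec m" "v' \<in> carrier_vec m" "w \<in> carrier_vec n" "w' \<in> carrier_vec n"
  shows "kron_vec v w \<bullet>c kron_vec v' w' = (v \<bullet>c v') * (w \<bullet>c w')"
proof -
  have "kron_vec v w \<bullet>c kron_vec v' w' = (\<Sum>a<m. \<Sum>b<n. v $ a * w $ b * cnj (v' $ a * w' $ b))"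
    using assms carrier_vecD[OF kron_vec_carrier[OF assms(2,4)]]
    unfolding cscalar_eq_sum
    by (simp add: sum_lessThan_mult kron_vec_def mult_add_less)
  also have "\<dots> = (v \<bullet>c v') * (w \<bullet>c w')"
    using assms by (simp add: cscalar_eq_sum sum_product algebra_simps)
  finally show ?thesis .
qed

lemma tensor_pow_vec_carrier: "v \<in> carrier_vec d \<Longrightarrow> tensor_pow_vec v n \<in> carrier_vec (d ^ n)"
  by (induction n) (auto intro: kron_vec_carrier)

lemma kron_mat_ketbra: "kron_mat (ketbra v) (ketbra w) = ketbra (kron_vec v w)"
  by (rule eq_matI)
     (auto simp: kron_mat_def ketbra_def kron_vec_def less_mult_imp_div_less mod_mult_less)

lemma tensor_pow_mat_ketbra: "tensor_pow_mat (ketbra v) n = ketbra (tensor_pow_vec v n)"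
proof (induction n)
  case 0
  show ?case by (rule eq_matI) (auto simp: ketbra_def)
qed (simp add: kron_mat_ketbra)

section \<open>Expansion of tensor powers over words\<close>

primrec kron_list :: "('a \<Rightarrow> complex vec) \<Rightarrow> 'a list \<Rightarrow> complex vec" where
  "kron_list g [] = vec 1 (\<lambda>_. 1)"
| "kron_list g (x # xs) = kron_vec (g x) (kron_list g xs)"

lemma kron_list_carrier:
  assumes "\<And>x. g x \<in> carrier_vec d" shows "kron_list g xs \<in> carrier_vec (d ^ length xs)"
  by (induction xs) (auto intro!: kron_vec_carrier assms)

definition words :: "'a set \<Rightarrow> nat \<Rightarrow> 'a list set" where
  "words S n = {w. set w \<subseteq> S \<and> length w = n}"

lemma words_0 [simp]: "words S 0 = {[]}"
  by (auto simp: words_def)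

lemma finite_words: "finite S \<Longrightarrow> finite (words S n)"
  unfolding words_def by (rule finite_lists_length_eq)

lemma sum_words_Suc: "(\<Sum>w\<in>words S (Suc n). f w) = (\<Sum>x\<in>S. \<Sum>w\<in>words S n. f (x # w))"
proof -
  have "(\<Sum>w\<in>words S (Suc n). f w) = (\<Sum>(x, w)\<in>S \<times> words S n. f (x # w))"
    by (rule sum.reindex_bij_witness[where i = "\<lambda>(x, w). x # w" and j = "\<lambda>w. (hd w, tl w)"])
       (auto simp: words_def length_Suc_conv)
  thus ?thesis by (simp add: sum.cartesian_product)
qed

text \<open>The general distributive law. It serves both to normalise the product distribution on
  words and to factorise its exponential moment.\<close>

lemma sum_words_prod_list:
  fixes f :: "'a \<Rightarrow> 'b::comm_semiring_1"
  shows "(\<Sum>w\<in>words S n. prod_list (map f w)) = (\<Sum>x\<in>S. f x) ^ n"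
  by (induction n) (simp_all add: sum_words_Suc sum_distrib_left[symmetric] sum_distrib_right)

text \<open>Coordinatewise multiplication of \<open>n\<close> equal sums. Coefficients are kept
  apart from vectors because in the application only the coefficients depend on time.\<close>

lemma tensor_pow_vec_expand:
  assumes "finite S" and g: "\<And>x. g x \<in> carrier_vec d" and v: "v \<in> carrier_vec d"
    and "\<And>i. i < d \<Longrightarrow> v $ i = (\<Sum>x\<in>S. a x * g x $ i)"
  shows "tensor_pow_vec v n = vec_sum (d ^ n) (words S n) (\<lambda>w. prod_list (map a w) \<cdot>\<^sub>v kron_list g w)"
proof (rule eq_vecI)
  have dim: "dim_vec (kron_list g w) = d ^ length w" for w
    using kron_list_carrier[of g d, OF g] by auto
  fix i assume "i < dim_vec (vec_sum (d ^ n) (words S n) (\<lambda>w. prod_list (map a w) \<cdot>\<^sub>v kron_list g w))"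
  hence "i < d ^ n" by simp
  hence "tensor_pow_vec v n $ i = (\<Sum>w\<in>words S n. prod_list (map a w) * kron_list g w $ i)"
  proof (induction n arbitrary: i)
    case (Suc n)
    have i: "i < d * d ^ n" using Suc.prems by simp
    have lt: "i div d ^ n < d" "i mod d ^ n < d ^ n"
      using i by (auto simp: less_mult_imp_div_less mod_mult_less)
    have kl: "kron_list g w \<in> carrier_vec (d ^ n)" if "w \<in> words S n" for w
      using that kron_list_carrier[of g d, OF g] by (auto simp: words_def)
    have "tensor_pow_vec v (Suc n) $ i = v $ (i div d ^ n) * tensor_pow_vec v n $ (i mod d ^ n)"
      by (simp add: kron_vec_index[OF v tensor_pow_vec_carrier[OF v] i])
    also have "\<dots> = (\<Sum>x\<in>S. a x * g x $ (i div d ^ n)) *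
        (\<Sum>w\<in>words S n. prod_list (map a w) * kron_list g w $ (i mod d ^ n))"
      using assms(4) Suc.IH lt by simp
    also have "\<dots> = (\<Sum>x\<in>S. \<Sum>w\<in>words S n. prod_list (map a (x # w)) * kron_list g (x # w) $ i)"
      unfolding sum_product
      by (intro sum.cong refl) (simp add: kron_vec_index[OF g kl i] algebra_simps)
    finally show ?case by (simp only: sum_words_Suc)
  qed simp
  thus "tensor_pow_vec v n $ i = vec_sum (d ^ n) (words S n) (\<lambda>w. prod_list (map a w) \<cdot>\<^sub>v kron_list g w) $ i"
    using \<open>i < d ^ n\<close> by (simp add: dim words_def)
qed (use tensor_pow_vec_carrier[OF v] in auto)

text \<open>The inner product factorises over positions, and distinct words of equal length differ
  at some position, where orthogonality of the letters makes a factor vanish.\<close>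

lemma cscalar_kron_list:
  fixes g :: "'a \<Rightarrow> complex vec"
  assumes g: "\<And>x. g x \<in> carrier_vec d" and orth: "\<And>x y. x \<noteq> y \<Longrightarrow> g x \<bullet>c g y = 0"
    and norm: "\<And>x. g x \<bullet>c g x = complex_of_real (p x)"
  shows "length w = length w' \<Longrightarrow>
    kron_list g w \<bullet>c kron_list g w' = (if w = w' then complex_of_real (prod_list (map p w)) else 0)"
proof (induction w arbitrary: w')
  case Nil thus ?case by (simp add: cscalar_eq_sum)
next
  case (Cons x w)
  then obtain y v where w': "w' = y # v" and len: "length w = length v" by (cases w') auto
  have "kron_list g (x # w) \<bullet>c kron_list g w' = (g x \<bullet>c g y) * (kron_list g w \<bullet>c kron_list g v)"
    unfolding w' using kron_list_carrier[of g d, OF g, of w] kron_list_carrier[of g d, OF g, of v] len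
    by (simp add: cscalar_kron_vec[OF g g])
  thus ?case using Cons.IH[OF len] orth[of x y] norm by (auto simp: w')
qed

subsection \<open>Kraus maps\<close>

lemma mat_adjoint_dim [simp]:
  fixes A :: "complex mat"
  shows "dim_row (mat_adjoint A) = dim_col A" "dim_col (mat_adjoint A) = dim_row A"
  by (simp_all add: mat_adjoint_def)

lemma ketbra_carrier: "v \<in> carrier_vec n \<Longrightarrow> ketbra v \<in> carrier_mat n n"
  by (simp add: ketbra_def)

definition kraus :: "complex mat \<Rightarrow> complex mat \<Rightarrow> complex mat" where
  "kraus Q X = Q * X * mat_adjoint Q"

lemma kraus_carrier: "Q \<in> carrier_mat n m \<Longrightarrow> X \<in> carrier_mat m m \<Longrightarrow> kraus Q X \<in> carrier_mat n n"
  unfolding kraus_def by (intro mult_carrier_mat[of _ n m] mult_carrier_mat[of _ n m] mat_adjoint_carrier)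

lemma kraus_index:
  assumes Q: "Q \<in> carrier_mat n m" and X: "X \<in> carrier_mat m m" and ij: "i < n" "j < n"
  shows "kraus Q X $$ (i, j) = (\<Sum>a<m. \<Sum>b<m. Q $$ (i, a) * X $$ (a, b) * cnj (Q $$ (j, b)))"
proof -
  have "kraus Q X $$ (i, j) = (\<Sum>b<m. (Q * X) $$ (i, b) * mat_adjoint Q $$ (b, j))"
    using assms by (simp add: kraus_def scalar_prod_def atLeast0LessThan)
  also have "\<dots> = (\<Sum>b<m. \<Sum>a<m. Q $$ (i, a) * X $$ (a, b) * cnj (Q $$ (j, b)))"
    using assms by (simp add: mat_adjoint_index[OF Q] scalar_prod_def atLeast0LessThan sum_distrib_right)
  also have "\<dots> = (\<Sum>a<m. \<Sum>b<m. Q $$ (i, a) * X $$ (a, b) * cnj (Q $$ (j, b)))" by (rule sum.swap)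
  finally show ?thesis .
qed

lemma psd_kraus:
  assumes Q: "Q \<in> carrier_mat n m" and X: "psd_mat m X"
  shows "psd_mat n (kraus Q X)"
  unfolding psd_mat_def
proof (intro conjI ballI)
  have Xc: "X \<in> carrier_mat m m" using X by (simp add: psd_mat_def)
  show "kraus Q X \<in> carrier_mat n n" by (rule kraus_carrier[OF Q Xc])
  fix v :: "complex vec" assume v: "v \<in> carrier_vec n"
  let ?u = "mat_adjoint Q *\<^sub>v v"
  have u: "?u \<in> carrier_vec m" by (rule mult_mat_vec_carrier[OF mat_adjoint_carrier[OF Q] v])
  have Xu: "X *\<^sub>v ?u \<in> carrier_vec m" by (rule mult_mat_vec_carrier[OF Xc u])
  have "kraus Q X *\<^sub>v v = Q *\<^sub>v (X *\<^sub>v ?u)"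
    unfolding kraus_def assoc_mult_mat_vec[OF mult_carrier_mat[OF Q Xc] mat_adjoint_carrier[OF Q] v]
    by (rule assoc_mult_mat_vec[OF Q Xc u])
  hence "(kraus Q X *\<^sub>v v) \<bullet>c v = (X *\<^sub>v ?u) \<bullet>c ?u"
    by (simp add: cscalar_adjoint[OF Q Xu v])
  thus "0 \<le> (kraus Q X *\<^sub>v v) \<bullet>c v" using X u by (simp add: psd_mat_def)
qed

lemma linear_kraus:
  assumes Q: "Q \<in> carrier_mat n m" shows "linear_mat_map m n (kraus Q)"
  unfolding linear_mat_map_def
proof (intro conjI ballI allI)
  fix A B :: "complex mat" assume AB: "A \<in> carrier_mat m m" "B \<in> carrier_mat m m"
  show "kraus Q (A + B) = kraus Q A + kraus Q B"
    unfolding kraus_def mult_add_distrib_mat[OF Q AB]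
    by (rule add_mult_distrib_mat[OF mult_carrier_mat[OF Q AB(1)] mult_carrier_mat[OF Q AB(2)] mat_adjoint_carrier[OF Q]])
next
  fix c and A :: "complex mat" assume A: "A \<in> carrier_mat m m"
  show "kraus Q (c \<cdot>\<^sub>m A) = c \<cdot>\<^sub>m kraus Q A"
    unfolding kraus_def mult_smult_distrib[OF Q A]
    by (rule mult_smult_assoc_mat[OF mult_carrier_mat[OF Q A] mat_adjoint_carrier[OF Q]])
qed (rule kraus_carrier[OF Q])

text \<open>The ampliation of the Kraus map of \<open>Q\<close> is the Kraus map of \<open>1 \<otimes> Q\<close>.\<close>

lemma completely_positive_kraus:
  assumes Q: "Q \<in> carrier_mat n m" shows "completely_positive m n (kraus Q)"
  unfolding completely_positive_def
proof (intro allI impI)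
  fix k X assume X: "psd_mat (k * m) X"
  define W where "W = mat (k * n) (k * m)
    (\<lambda>(i, r). if i div n = r div m then Q $$ (i mod n, r mod m) else 0)"
  have W: "W \<in> carrier_mat (k * n) (k * m)" by (simp add: W_def)
  have Xc: "X \<in> carrier_mat (k * m) (k * m)" using X by (simp add: psd_mat_def)
  have "ampliation k m n (kraus Q) X = kraus W X"
  proof (rule eq_matI)
    fix i j assume "i < dim_row (kraus W X)" "j < dim_col (kraus W X)"
    hence ij: "i < k * n" "j < k * n" using kraus_carrier[OF W Xc] by auto
    have dv: "i div n < k" "j div n < k" "i mod n < n" "j mod n < n"
      using ij by (auto simp: less_mult_imp_div_less mod_mult_less)
    have "kraus W X $$ (i, j) = (\<Sum>I<k. \<Sum>a<m. \<Sum>J<k. \<Sum>b<m.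
        W $$ (i, I * m + a) * X $$ (I * m + a, J * m + b) * cnj (W $$ (j, J * m + b)))"
      by (simp add: kraus_index[OF W Xc ij] sum_lessThan_mult)
    \<comment> \<open>Both matrices \<open>W\<close> are block diagonal, so each sum over blocks has
      a single nonzero term; the conditions are placed directly under the sum that they
      collapse.\<close>
    also have "\<dots> = (\<Sum>I<k. if I = i div n then \<Sum>a<m. \<Sum>J<k. if J = j div n then \<Sum>b<m.
        Q $$ (i mod n, a) * X $$ (I * m + a, J * m + b) * cnj (Q $$ (j mod n, b)) else 0 else 0)"
    proof (intro sum.cong refl, goal_cases)
      case (1 I)
      have "W $$ (i, I * m + a) = (if I = i div n then Q $$ (i mod n, a) else 0)" if "a < m" for a
        using 1 that ij mult_add_less[of I k a m] by (simp add: W_def)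
      moreover have "W $$ (j, J * m + b) = (if J = j div n then Q $$ (j mod n, b) else 0)"
        if "b < m" "J < k" for b J
        using that ij mult_add_less[of J k b m] by (simp add: W_def)
      ultimately have "W $$ (i, I * m + a) * X $$ (I * m + a, J * m + b) * cnj (W $$ (j, J * m + b)) =
          (if I = i div n then if J = j div n then
             Q $$ (i mod n, a) * X $$ (I * m + a, J * m + b) * cnj (Q $$ (j mod n, b)) else 0 else 0)"
        if "a < m" "b < m" "J < k" for a b J using that by simp
      hence "(\<Sum>a<m. \<Sum>J<k. \<Sum>b<m.
          W $$ (i, I * m + a) * X $$ (I * m + a, J * m + b) * cnj (W $$ (j, J * m + b))) =
          (\<Sum>a<m. \<Sum>J<k. \<Sum>b<m. if I = i div n then if J = j div n then
             Q $$ (i mod n, a) * X $$ (I * m + a, J * m + b) * cnj (Q $$ (j mod n, b)) else 0 else 0)"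
        by (intro sum.cong refl) simp
      also have "\<dots> = (if I = i div n then \<Sum>a<m. \<Sum>J<k. if J = j div n then \<Sum>b<m.
        Q $$ (i mod n, a) * X $$ (I * m + a, J * m + b) * cnj (Q $$ (j mod n, b)) else 0 else 0)"
      proof (cases "I = i div n")
        case True
        show ?thesis unfolding if_P[OF True] by (intro sum.cong refl) simp
      qed simp
      finally show ?case .
    qed
    also have "\<dots> = (\<Sum>a<m. \<Sum>b<m.
        Q $$ (i mod n, a) * X $$ (i div n * m + a, j div n * m + b) * cnj (Q $$ (j mod n, b)))"
      using dv by simp
    also have "\<dots> = ampliation k m n (kraus Q) X $$ (i, j)"
      using ij by (simp add: ampliation_def kraus_index[OF Q _ dv(3,4)])
    finally show "ampliation k m n (kraus Q) X $$ (i, j) = kraus W X $$ (i, j)" by simp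
  qed (use kraus_carrier[OF W Xc] in \<open>auto simp: ampliation_def\<close>)
  thus "psd_mat (k * n) (ampliation k m n (kraus Q) X)"
    using psd_kraus[OF W X] by simp
qed

text \<open>The quadratic form is tested on \<open>e_a + z e_b\<close> with \<open>z\<close> a
  fourth root of unity. This bounds the real and imaginary parts by half the sum of two diagonal
  entries, hence by the trace. The factor 2 comes from bounding the modulus by the sum of both
  parts.\<close>

lemma psd_entry_bound:
  assumes X: "psd_mat m X" and ab: "a < m" "b < m"
  shows "cmod (X $$ (a, b)) \<le> 2 * Re (mat_trace X)"
proof -
  have Xc: "X \<in> carrier_mat m m" using X by (simp add: psd_mat_def)
  have ent: "(\<Sum>i<m. \<Sum>j<m. X $$ (i, j) * v $ j * cnj (v $ i)) \<ge> 0" if "v \<in> carrier_vec m" for v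
  proof -
    have "0 \<le> (X *\<^sub>v v) \<bullet>c v" using X that by (simp add: psd_mat_def)
    also have "(X *\<^sub>v v) \<bullet>c v = (\<Sum>i<m. \<Sum>j<m. X $$ (i, j) * v $ j * cnj (v $ i))"
      using that by (simp add: cscalar_eq_sum mult_mat_vec_index[OF Xc that] sum_distrib_right del: index_mult_mat_vec)
    finally show ?thesis .
  qed
  have off: "X $$ (a, a) + z * X $$ (a, b) + cnj z * X $$ (b, a) + z * cnj z * X $$ (b, b) \<ge> 0"
    if ab: "a < m" "b < m" for a b z
  proof -
    \<comment> \<open>The indicators are added rather than distinguished by cases: for
      \<open>a = b\<close> the entry is \<open>1 + z\<close>, so \<open>off\<close> also yields the
      diagonal entries.\<close>
    define v where "v = vec m (\<lambda>i. (if i = a then 1 else 0) + (if i = b then z else 0))"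
    have inner: "(\<Sum>j<m. X $$ (i, j) * v $ j * w) = (X $$ (i, a) + X $$ (i, b) * z) * w" for i w
    proof -
      have "(\<Sum>j<m. X $$ (i, j) * v $ j * w)
          = (\<Sum>j<m. (if j = a then X $$ (i, j) * w else 0) + (if j = b then X $$ (i, j) * z * w else 0))"
        by (intro sum.cong refl) (auto simp: v_def algebra_simps)
      thus ?thesis using ab by (simp add: sum.distrib algebra_simps)
    qed
    have "(\<Sum>i<m. \<Sum>j<m. X $$ (i, j) * v $ j * cnj (v $ i))
        = (\<Sum>i<m. (if i = a then X $$ (i, a) + X $$ (i, b) * z else 0)
              + (if i = b then (X $$ (i, a) + X $$ (i, b) * z) * cnj z else 0))"
      unfolding inner by (intro sum.cong refl) (auto simp: v_def algebra_simps)
    thus ?thesis using ent[of v] ab by (simp add: sum.distrib v_def algebra_simps)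
  qed
  have diag: "X $$ (i, i) \<ge> 0" if "i < m" for i
    using off[OF that that, of 0] by simp
  have le_tr: "Re (X $$ (i, i)) \<le> Re (mat_trace X)" if "i < m" for i
  proof -
    have "Re (X $$ (i, i)) \<le> (\<Sum>k<m. Re (X $$ (k, k)))"
      using that diag by (intro member_le_sum) (auto simp: less_eq_complex_def)
    thus ?thesis using Xc by (simp add: mat_trace_def)
  qed
  \<comment> \<open>The values \<open>1\<close> and \<open>-1\<close> of \<open>z\<close> control
    the real part, \<open>\<i>\<close> and \<open>-\<i>\<close> the imaginary part. Since the form
    is real, they also force \<open>X $$ (b, a)\<close> to be the conjugate of
    \<open>X $$ (a, b)\<close>.\<close>
  have "\<bar>Re (X $$ (a, b))\<bar> \<le> Re (mat_trace X)" "\<bar>Im (X $$ (a, b))\<bar> \<le> Re (mat_trace X)"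
    using off[OF ab, of 1] off[OF ab, of "-1"] off[OF ab, of \<i>] off[OF ab, of "-\<i>"] le_tr[OF ab(1)] le_tr[OF ab(2)]
    by (auto simp: less_eq_complex_def)
  thus ?thesis using cmod_le[of "X $$ (a, b)"] by linarith
qed

text \<open>A crude substitute for the condition that the adjoint of \<open>Q\<close> times
  \<open>Q\<close> is at most 1: the entries of \<open>X\<close> are replaced by the bound of
  \<open>psd_entry_bound\<close>, which is the source of the factor 2. It suffices because
  \<open>Q\<close> is later rescaled freely.\<close>

lemma trace_nonincreasing_kraus:
  assumes Q: "Q \<in> carrier_mat n m"
    and small: "2 * (\<Sum>i<n. (\<Sum>a<m. cmod (Q $$ (i, a)))\<^sup>2) \<le> 1"
  shows "trace_nonincreasing m (kraus Q)"
  unfolding trace_nonincreasing_def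
proof (intro allI impI)
  fix X assume X: "psd_mat m X"
  have Xc: "X \<in> carrier_mat m m" using X by (simp add: psd_mat_def)
  let ?T = "Re (mat_trace X)"
  have T: "?T \<ge> 0"
  proof (cases "m = 0")
    case False
    thus ?thesis using psd_entry_bound[OF X, of 0 0] norm_ge_zero[of "X $$ (0, 0)"] by linarith
  qed (use Xc in \<open>simp add: mat_trace_def\<close>)
  have tr: "mat_trace (kraus Q X)
      = (\<Sum>i<n. \<Sum>a<m. \<Sum>b<m. Q $$ (i, a) * X $$ (a, b) * cnj (Q $$ (i, b)))"
    using kraus_carrier[OF Q Xc] by (simp add: mat_trace_def kraus_index[OF Q Xc])
  have "Re (mat_trace (kraus Q X)) \<le> cmod (mat_trace (kraus Q X))" by (rule complex_Re_le_cmod)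
  also have "\<dots> \<le> (\<Sum>i<n. \<Sum>a<m. \<Sum>b<m. cmod (Q $$ (i, a)) * (2 * ?T) * cmod (Q $$ (i, b)))"
    unfolding tr using psd_entry_bound[OF X]
    by (intro order.trans[OF norm_sum] sum_mono) (auto simp: norm_mult intro!: mult_left_mono mult_right_mono)
  also have "\<dots> = (2 * (\<Sum>i<n. (\<Sum>a<m. cmod (Q $$ (i, a)))\<^sup>2)) * ?T"
    by (simp add: power2_eq_square sum_product sum_distrib_left sum_distrib_right algebra_simps)
  also have "\<dots> \<le> 1 * ?T" by (intro mult_right_mono small T)
  finally show "Re (mat_trace (kraus Q X)) \<le> Re (mat_trace X)" by simp
qed

lemma exists_trace_nonincreasing_scaling:
  assumes Q: "Q \<in> carrier_mat n m"
  obtains \<gamma> :: real where "\<gamma> > 0" "trace_nonincreasing m (kraus (complex_of_real \<gamma> \<cdot>\<^sub>m Q))"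
proof -
  define C where "C = 2 * (\<Sum>i<n. (\<Sum>a<m. cmod (Q $$ (i, a)))\<^sup>2)"
  have C: "C \<ge> 0" by (simp add: C_def sum_nonneg)
  \<comment> \<open>This value makes both \<gamma> and \<open>\<gamma> * C\<close> at most 1, hence
    \<open>\<gamma>^2 * C\<close> as well, and stays positive when \<open>C = 0\<close>.\<close>
  define \<gamma> where "\<gamma> = 1 / (1 + C)"
  have \<gamma>: "\<gamma> > 0" "\<gamma> \<le> 1" "\<gamma> * C \<le> 1" using C by (auto simp: \<gamma>_def field_simps)
  have "2 * (\<Sum>i<n. (\<Sum>a<m. cmod ((complex_of_real \<gamma> \<cdot>\<^sub>m Q) $$ (i, a)))\<^sup>2) = \<gamma>\<^sup>2 * C"
    using Q \<gamma> by (simp add: C_def norm_mult sum_distrib_left[symmetric] power_mult_distrib)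
  also have "\<dots> = \<gamma> * (\<gamma> * C)" by (simp add: power2_eq_square)
  also have "\<dots> \<le> 1 * 1" using \<gamma> C by (intro mult_mono) auto
  finally have "trace_nonincreasing m (kraus (complex_of_real \<gamma> \<cdot>\<^sub>m Q))"
    using Q by (intro trace_nonincreasing_kraus[of _ n]) auto
  thus ?thesis using \<gamma> that by blast
qed

lemma kraus_ketbra:
  assumes Q: "Q \<in> carrier_mat n m" and v: "v \<in> carrier_vec m"
  shows "kraus Q (ketbra v) = ketbra (Q *\<^sub>v v)"
proof (rule eq_matI)
  have Qv: "Q *\<^sub>v v \<in> carrier_vec n" by (rule mult_mat_vec_carrier[OF Q v])
  fix i j assume "i < dim_row (ketbra (Q *\<^sub>v v))" "j < dim_col (ketbra (Q *\<^sub>v v))"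
  hence ij: "i < n" "j < n" using ketbra_carrier[OF Qv] by auto
  have "kraus Q (ketbra v) $$ (i, j) = (\<Sum>a<m. \<Sum>b<m. Q $$ (i, a) * v $ a * cnj (Q $$ (j, b) * v $ b))"
    unfolding kraus_index[OF Q ketbra_carrier[OF v] ij] using v
    by (intro sum.cong refl) (simp add: ketbra_def algebra_simps)
  also have "\<dots> = (Q *\<^sub>v v) $ i * cnj ((Q *\<^sub>v v) $ j)"
    using ij by (simp add: mult_mat_vec_index[OF Q v] sum_product del: index_mult_mat_vec)
  finally show "kraus Q (ketbra v) $$ (i, j) = ketbra (Q *\<^sub>v v) $$ (i, j)"
    using ij carrier_vecD[OF Qv] by (simp add: ketbra_def del: index_mult_mat_vec)
qed (use Q in \<open>auto simp: kraus_def ketbra_def\<close>)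

lemma mat_trace_ketbra: "mat_trace (ketbra v) = v \<bullet>c v"
  by (simp add: mat_trace_def ketbra_def cscalar_eq_sum)

lemma cscalar_ketbra:
  assumes "v \<in> carrier_vec n" "x \<in> carrier_vec n"
  shows "(ketbra v *\<^sub>v x) \<bullet>c x = (v \<bullet>c x) * (x \<bullet>c v)"
proof -
  have "(ketbra v *\<^sub>v x) \<bullet>c x = (\<Sum>i<n. \<Sum>j<n. v $ i * cnj (x $ i) * (x $ j * cnj (v $ j)))"
    unfolding cscalar_eq_sum carrier_vecD[OF assms(2)]
  proof (rule sum.cong[OF refl])
    fix i assume "i \<in> {..<n}"
    hence i: "i < n" by simp
    show "(ketbra v *\<^sub>v x) $ i * cnj (x $ i) = (\<Sum>j<n. v $ i * cnj (x $ i) * (x $ j * cnj (v $ j)))"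
      unfolding mult_mat_vec_index[OF ketbra_carrier[OF assms(1)] assms(2) i] sum_distrib_right
      using assms i by (intro sum.cong refl) (simp add: ketbra_def algebra_simps)
  qed
  thus ?thesis using assms by (simp add: cscalar_eq_sum sum_product)
qed

subsection \<open>Filtering the energy words\<close>

lemma prod_list_pos:
  fixes p :: "'a \<Rightarrow> real"
  assumes "\<And>x. x \<in> S \<Longrightarrow> p x > 0"
  shows "set w \<subseteq> S \<Longrightarrow> prod_list (map p w) > 0"
  by (induction w) (auto simp: assms)

lemma cmod_prod_list_unit:
  assumes "\<And>x. x \<in> S \<Longrightarrow> cmod (a x) = 1"
  shows "set w \<subseteq> S \<Longrightarrow> cmod (prod_list (map a w)) = 1"
  by (induction w) (auto simp: assms norm_mult)

text \<open>The Kraus operator is \<open>\<gamma> \<Sum>w\<in>A. |g w\<rangle>\<langle>g (u w)| / p (u w)\<close>, with \<open>g\<close> and \<open>p\<close> extended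
  multiplicatively to words; it maps the \<open>N\<close>-fold tensor power of \<open>\<phi> t\<close> to a multiple of the projection
  of the \<open>M\<close>-fold one onto the span of the \<open>g w\<close>.\<close>

lemma exists_filter_process:
  fixes g :: "'a \<Rightarrow> complex vec" and p :: "'a \<Rightarrow> real" and \<phi> :: "real \<Rightarrow> complex vec"
    and a :: "real \<Rightarrow> 'a \<Rightarrow> complex" and \<kappa> :: "real \<Rightarrow> complex" and u :: "'a list \<Rightarrow> 'a list"
  assumes S: "finite S"
    and g: "\<And>x. g x \<in> carrier_vec d" and orth: "\<And>x y. x \<noteq> y \<Longrightarrow> g x \<bullet>c g y = 0"
    and norm: "\<And>x. g x \<bullet>c g x = complex_of_real (p x)" and p: "\<And>x. x \<in> S \<Longrightarrow> p x > 0"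
    and \<phi>: "\<And>t. \<phi> t \<in> carrier_vec d"
    and expand: "\<And>t i. i < d \<Longrightarrow> \<phi> t $ i = (\<Sum>x\<in>S. a t x * g x $ i)"
    and unit: "\<And>t x. x \<in> S \<Longrightarrow> cmod (a t x) = 1"
    and A: "A \<subseteq> words S M" "A \<noteq> {}" and u: "\<And>w. w \<in> A \<Longrightarrow> u w \<in> words S N"
    and phase: "\<And>t w. w \<in> A \<Longrightarrow> prod_list (map (a t) (u w)) = \<kappa> t * prod_list (map (a t) w)"
    and \<kappa>: "\<And>t. cmod (\<kappa> t) = 1"
  obtains \<P> where "replication_process d N M \<P>" "\<And>t. success_prob N \<P> (\<phi> t) \<noteq> 0"
    "fidelity N M \<P> \<phi> = (\<Sum>w\<in>A. prod_list (map p w))"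
proof -
  define ph where "ph t w = prod_list (map (a t) w)" for t w
  define pp where "pp w = prod_list (map p w)" for w
  define PA where "PA = (\<Sum>w\<in>A. pp w)"
  have finA: "finite A" using A(1) finite_words[OF S] finite_subset by blast
  have wordsD: "w \<in> words S k \<Longrightarrow> set w \<subseteq> S \<and> length w = k" for w k by (simp add: words_def)
  have AD: "w \<in> words S M" "set w \<subseteq> S" "length w = M" if "w \<in> A" for w
    using that A(1) by (auto simp: words_def)
  have pp_pos: "pp w > 0" if "w \<in> words S k" for w k
    unfolding pp_def using wordsD[OF that] by (intro prod_list_pos[of S] p) auto
  have PA_pos: "PA > 0" unfolding PA_def using pp_pos[OF AD(1)] A(2) finA by (intro sum_pos)
  have ph_unit: "cmod (ph t w) = 1" if "w \<in> words S k" for t w k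
    unfolding ph_def using wordsD[OF that] by (intro cmod_prod_list_unit[of S] unit) auto
  have kl: "kron_list g w \<in> carrier_vec (d ^ k)" if "w \<in> words S k" for w k
    using kron_list_carrier[of g d w, OF g] wordsD[OF that] by simp
  have kl_dim: "dim_vec (kron_list g w) = d ^ k" if "w \<in> words S k" for w k
    using kl[OF that] by auto
  have ortho: "kron_list g w \<bullet>c kron_list g w' = (if w = w' then complex_of_real (pp w) else 0)"
    if "w \<in> words S k" "w' \<in> words S k" for w w' k
    using cscalar_kron_list[of g d p w w', OF g orth norm] wordsD[OF that(1)] wordsD[OF that(2)]
    by (simp add: pp_def)
  have tp: "tensor_pow_vec (\<phi> t) k = vec_sum (d ^ k) (words S k) (\<lambda>w. ph t w \<cdot>\<^sub>v kron_list g w)" for t k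
    unfolding ph_def by (rule tensor_pow_vec_expand[OF S g \<phi> expand])
  have tp_carrier: "tensor_pow_vec (\<phi> t) k \<in> carrier_vec (d ^ k)" for t k
    by (rule tensor_pow_vec_carrier[OF \<phi>])
  have tp_kl: "tensor_pow_vec (\<phi> t) k \<bullet>c kron_list g w = ph t w * pp w" if w: "w \<in> words S k" for t k w
  proof -
    have "tensor_pow_vec (\<phi> t) k \<bullet>c kron_list g w
        = (\<Sum>w'\<in>words S k. (ph t w' \<cdot>\<^sub>v kron_list g w') \<bullet>c kron_list g w)"
      unfolding tp by (rule cscalar_vec_sum_left[OF kl[OF w]])
    also have "\<dots> = (\<Sum>w'\<in>words S k. if w' = w then ph t w * pp w else 0)"
      using w by (intro sum.cong refl) (auto simp: cscalar_smult_left[OF kl kl] ortho)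
    also have "\<dots> = ph t w * pp w" using w finite_words[OF S] by simp
    finally show ?thesis .
  qed
  \<comment> \<open>The orthogonal projection of the \<open>M\<close>-fold power onto the words in
    \<open>A\<close>; hence its overlap with that power equals its squared norm, and both are
    \<open>PA\<close>.\<close>
  define \<chi> where "\<chi> t = vec_sum (d ^ M) A (\<lambda>w. ph t w \<cdot>\<^sub>v kron_list g w)" for t
  have \<chi>: "\<chi> t \<in> carrier_vec (d ^ M)" for t by (simp add: \<chi>_def)
  have unit_sq: "ph t w * cnj (ph t w) = 1" if "w \<in> words S k" for t w k
    using ph_unit[OF that, of t] by (simp add: complex_norm_square[symmetric])
  have tp_\<chi>: "tensor_pow_vec (\<phi> t) M \<bullet>c \<chi> t = PA" for t
  proof -
    have "tensor_pow_vec (\<phi> t) M \<bullet>c \<chi> t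
        = (\<Sum>w\<in>A. tensor_pow_vec (\<phi> t) M \<bullet>c (ph t w \<cdot>\<^sub>v kron_list g w))"
      unfolding \<chi>_def using AD kl by (intro cscalar_vec_sum_right) auto
    also have "\<dots> = (\<Sum>w\<in>A. ph t w * cnj (ph t w) * pp w)"
      using AD by (intro sum.cong refl) (simp add: cscalar_smult_right[OF tp_carrier kl] tp_kl)
    also have "\<dots> = (\<Sum>w\<in>A. complex_of_real (pp w))"
      by (intro sum.cong refl) (simp add: unit_sq[OF AD(1)])
    finally show ?thesis by (simp add: PA_def)
  qed
  have \<chi>_kl: "\<chi> t \<bullet>c kron_list g w = ph t w * pp w" if w: "w \<in> A" for t w
  proof -
    have "\<chi> t \<bullet>c kron_list g w = (\<Sum>w'\<in>A. (ph t w' \<cdot>\<^sub>v kron_list g w') \<bullet>c kron_list g w)"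
      unfolding \<chi>_def by (rule cscalar_vec_sum_left[OF kl[OF AD(1)[OF w]]])
    also have "\<dots> = (\<Sum>w'\<in>A. if w' = w then ph t w * pp w else 0)"
    proof (rule sum.cong[OF refl])
      fix w' assume "w' \<in> A"
      note w' = AD(1)[OF this] and w = AD(1)[OF w]
      show "(ph t w' \<cdot>\<^sub>v kron_list g w') \<bullet>c kron_list g w = (if w' = w then ph t w * pp w else 0)"
        by (simp add: cscalar_smult_left[OF kl[OF w'] kl[OF w]] ortho[OF w' w])
    qed
    also have "\<dots> = ph t w * pp w" using w finA by simp
    finally show ?thesis .
  qed
  have \<chi>_\<chi>: "\<chi> t \<bullet>c \<chi> t = PA" for t
  proof -
    have "\<chi> t \<bullet>c \<chi> t = (\<Sum>w\<in>A. \<chi> t \<bullet>c (ph t w \<cdot>\<^sub>v kron_list g w))"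
      by (subst (2) \<chi>_def, rule cscalar_vec_sum_right) (use AD kl in auto)
    also have "\<dots> = (\<Sum>w\<in>A. ph t w * cnj (ph t w) * pp w)"
      using AD by (intro sum.cong refl) (simp add: cscalar_smult_right[OF \<chi> kl] \<chi>_kl)
    also have "\<dots> = (\<Sum>w\<in>A. complex_of_real (pp w))"
      by (intro sum.cong refl) (simp add: unit_sq[OF AD(1)])
    finally show ?thesis by (simp add: PA_def)
  qed
  define Q0 where "Q0 = mat (d ^ M) (d ^ N)
    (\<lambda>(i, j). \<Sum>w\<in>A. kron_list g w $ i * cnj (kron_list g (u w) $ j) / pp (u w))"
  have Q0: "Q0 \<in> carrier_mat (d ^ M) (d ^ N)" by (simp add: Q0_def)
  have Q0_tp: "Q0 *\<^sub>v tensor_pow_vec (\<phi> t) N = \<kappa> t \<cdot>\<^sub>v \<chi> t" for t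
  proof (rule eq_vecI)
    fix i assume "i < dim_vec (\<kappa> t \<cdot>\<^sub>v \<chi> t)"
    hence i: "i < d ^ M" by (simp add: \<chi>_def)
    have "(Q0 *\<^sub>v tensor_pow_vec (\<phi> t) N) $ i = (\<Sum>j<d ^ N. \<Sum>w\<in>A.
        kron_list g w $ i / pp (u w) * (tensor_pow_vec (\<phi> t) N $ j * cnj (kron_list g (u w) $ j)))"
      unfolding mult_mat_vec_index[OF Q0 tp_carrier i]
      using i by (intro sum.cong refl) (simp add: Q0_def sum_distrib_left algebra_simps)
    also have "\<dots> = (\<Sum>w\<in>A. \<Sum>j<d ^ N.
        kron_list g w $ i / pp (u w) * (tensor_pow_vec (\<phi> t) N $ j * cnj (kron_list g (u w) $ j)))"
      by (rule sum.swap)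
    also have "\<dots> = (\<Sum>w\<in>A. kron_list g w $ i / pp (u w) * (tensor_pow_vec (\<phi> t) N \<bullet>c kron_list g (u w)))"
      by (intro sum.cong refl) (simp add: cscalar_eq_sum kl_dim[OF u] sum_distrib_left)
    \<comment> \<open>The overlap with the word \<open>u w\<close> contributes the weight
      \<open>pp (u w)\<close>, which the denominator in \<open>Q0\<close> cancels;
      \<open>phase\<close> then exchanges the phase of \<open>u w\<close> for that of
      \<open>w\<close>.\<close>
    also have "\<dots> = (\<Sum>w\<in>A. \<kappa> t * (ph t w * kron_list g w $ i))"
    proof (rule sum.cong[OF refl])
      fix w assume w: "w \<in> A"
      have "pp (u w) \<noteq> 0" using pp_pos[OF u[OF w]] by simp
      thus "kron_list g w $ i / pp (u w) * (tensor_pow_vec (\<phi> t) N \<bullet>c kron_list g (u w))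
          = \<kappa> t * (ph t w * kron_list g w $ i)"
        unfolding tp_kl[OF u[OF w]] using phase[OF w] by (simp add: ph_def)
    qed
    also have "\<dots> = (\<kappa> t \<cdot>\<^sub>v \<chi> t) $ i"
      using i by (simp add: \<chi>_def sum_distrib_left kl_dim[OF AD(1)])
    finally show "(Q0 *\<^sub>v tensor_pow_vec (\<phi> t) N) $ i = (\<kappa> t \<cdot>\<^sub>v \<chi> t) $ i" .
  qed (simp add: Q0_def \<chi>_def)
  \<comment> \<open>Several words \<open>w\<close> may share the same \<open>u w\<close>, so nothing
    makes \<open>Q0\<close> a contraction as it stands.\<close>
  obtain \<gamma> :: real where \<gamma>: "\<gamma> > 0"
    "trace_nonincreasing (d ^ N) (kraus (complex_of_real \<gamma> \<cdot>\<^sub>m Q0))"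
    using exists_trace_nonincreasing_scaling[OF Q0] by blast
  define Q where "Q = complex_of_real \<gamma> \<cdot>\<^sub>m Q0"
  have Q: "Q \<in> carrier_mat (d ^ M) (d ^ N)" using Q0 by (simp add: Q_def)
  define c where "c t = complex_of_real \<gamma> * \<kappa> t" for t
  have c: "c t * cnj (c t) = complex_of_real (\<gamma>\<^sup>2)" for t
    unfolding complex_norm_square[symmetric] using \<kappa>[of t] by (simp add: c_def norm_mult)
  have Q_tp: "Q *\<^sub>v tensor_pow_vec (\<phi> t) N = c t \<cdot>\<^sub>v \<chi> t" for t
  proof -
    have "Q *\<^sub>v tensor_pow_vec (\<phi> t) N = complex_of_real \<gamma> \<cdot>\<^sub>v (Q0 *\<^sub>v tensor_pow_vec (\<phi> t) N)"
      using Q0 tp_carrier[of t N]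
      by (intro eq_vecI) (auto simp: Q_def scalar_prod_def sum_distrib_left mult.assoc)
    thus ?thesis by (simp add: Q0_tp c_def smult_smult_assoc)
  qed
  have out: "kraus Q (tensor_pow_mat (ketbra (\<phi> t)) N) = ketbra (c t \<cdot>\<^sub>v \<chi> t)" for t
    by (simp add: tensor_pow_mat_ketbra kraus_ketbra[OF Q tp_carrier] Q_tp)
  have c\<chi>: "c t \<cdot>\<^sub>v \<chi> t \<in> carrier_vec (d ^ M)" for t using \<chi> by simp
  have succ: "success_prob N (kraus Q) (\<phi> t) = \<gamma>\<^sup>2 * PA" for t
  proof -
    have "(c t \<cdot>\<^sub>v \<chi> t) \<bullet>c (c t \<cdot>\<^sub>v \<chi> t) = c t * cnj (c t) * PA"
      by (simp add: cscalar_smult_left[OF \<chi> c\<chi>] cscalar_smult_right[OF \<chi> \<chi>] \<chi>_\<chi>)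
    also have "\<dots> = complex_of_real (\<gamma>\<^sup>2 * PA)" by (simp only: c of_real_mult)
    finally show ?thesis unfolding success_prob_def out mat_trace_ketbra by (simp only: Re_complex_of_real)
  qed
  have overlap: "Re ((kraus Q (tensor_pow_mat (ketbra (\<phi> t)) N) *\<^sub>v tensor_pow_vec (\<phi> t) M)
      \<bullet>c tensor_pow_vec (\<phi> t) M) = \<gamma>\<^sup>2 * PA * PA" for t
  proof -
    have conj: "\<chi> t \<bullet>c tensor_pow_vec (\<phi> t) M = PA"
      using cscalar_cnj[of "tensor_pow_vec (\<phi> t) M" "\<chi> t"] tp_\<chi>[of t] tp_carrier[of t M] \<chi>[of t] by simp
    have "(ketbra (c t \<cdot>\<^sub>v \<chi> t) *\<^sub>v tensor_pow_vec (\<phi> t) M) \<bullet>c tensor_pow_vec (\<phi> t) M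
        = c t * cnj (c t) * (complex_of_real PA * PA)"
      by (simp add: cscalar_ketbra[OF c\<chi> tp_carrier] cscalar_smult_left[OF \<chi> tp_carrier]
          cscalar_smult_right[OF tp_carrier \<chi>] conj tp_\<chi>)
    also have "\<dots> = complex_of_real (\<gamma>\<^sup>2 * PA * PA)" by (simp only: c of_real_mult mult.assoc)
    finally show ?thesis unfolding out by (simp only: Re_complex_of_real)
  qed
  show ?thesis
  proof (rule that[of "kraus Q"])
    show "replication_process d N M (kraus Q)"
      using linear_kraus[OF Q] completely_positive_kraus[OF Q] \<gamma>(2)
      by (simp add: replication_process_def Q_def)
    show "success_prob N (kraus Q) (\<phi> t) \<noteq> 0" for t
      using \<gamma>(1) PA_pos by (simp add: succ)
    \<comment> \<open>The quotient \<open>\<gamma>^2 * PA * PA / (\<gamma>^2 * PA)\<close> equals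
      \<open>PA\<close> for every \<open>t\<close>, so the infimum is that of a constant.\<close>
    show "fidelity N M (kraus Q) \<phi> = (\<Sum>w\<in>A. prod_list (map p w))"
      using \<gamma>(1) PA_pos unfolding fidelity_def overlap succ by (simp add: PA_def pp_def)
  qed
qed

subsection \<open>Concentration of letter frequencies\<close>

text \<open>Hoeffding's lemma for a Bernoulli variable. The derivative \<open>v\<close> of the
  left-hand side is the success probability of the tilted variable, and
  \<open>v' = v * (1 - v)\<close> is at most 1/4; integrating twice from 0 gives the bound.\<close>

lemma ln_bernoulli_mgf_le:
  fixes h q :: real
  assumes h: "h \<ge> 0" and q: "0 \<le> q" "q \<le> 1"
  shows "ln (1 + q * (exp h - 1)) \<le> h * q + h\<^sup>2 / 8"
proof -
  define v where "v x = q * exp x / (1 + q * (exp x - 1))" for x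
  have pos: "0 < 1 + q * (exp x - 1)" for x :: real
  proof -
    have "0 < (1 - q) + q * exp x"
    proof (cases "q = 0")
      case False
      thus ?thesis using q by (intro add_nonneg_pos) auto
    qed simp
    thus ?thesis by (simp add: algebra_simps)
  qed
  have v': "(v has_real_derivative v x * (1 - v x)) (at x)" for x
    unfolding v_def using pos[of x]
    by (auto intro!: derivative_eq_intros simp: divide_simps) (simp add: algebra_simps power2_eq_square)
  have "v x * (1 - v x) \<le> 1 / 4" for x
  proof -
    have "0 \<le> (v x - 1 / 2)\<^sup>2" by simp
    thus ?thesis by (simp add: power2_eq_square algebra_simps)
  qed
  hence slope: "0 \<le> 1 / 4 - v x * (1 - v x)" for x by (simp only: diff_ge_0_iff_ge)
  have "((\<lambda>y. q + y / 4 - v y) has_real_derivative 1 / 4 - v x * (1 - v x)) (at x)" for x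
    by (auto intro!: derivative_eq_intros v')
  hence "q + 0 / 4 - v 0 \<le> q + x / 4 - v x" if "x \<ge> 0" for x
    using slope by (intro DERIV_nonneg_imp_nondecreasing[OF that]) blast
  hence v_le: "v x \<le> q + x / 4" if "x \<ge> 0" for x
    using that by (force simp: v_def)
  have "\<exists>y. ((\<lambda>y. (y * q + y\<^sup>2 / 8) - ln (1 + q * (exp y - 1))) has_real_derivative y) (at x) \<and> 0 \<le> y"
    if "0 \<le> x" for x
    using v_le[OF that] pos[of x]
    by (intro exI[of _ "q + x / 4 - v x"])
       (auto intro!: derivative_eq_intros simp: v_def)
  hence "(\<lambda>y. (y * q + y\<^sup>2 / 8) - ln (1 + q * (exp y - 1))) 0
      \<le> (\<lambda>y. (y * q + y\<^sup>2 / 8) - ln (1 + q * (exp y - 1))) h"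
    by (intro DERIV_nonneg_imp_nondecreasing[OF h]) auto
  thus ?thesis by simp
qed

text \<open>For a Bernoulli variable \<open>X\<close>, write \<open>exp (- l * X)\<close> as
  \<open>exp (- l) * exp (l * (1 - X))\<close>: the complement \<open>1 - X\<close> has parameter
  \<open>1 - p\<close>, and the previous bound applies to it.\<close>

lemma bernoulli_mgf_bound:
  fixes l p :: real
  assumes "l \<ge> 0" "0 \<le> p" "p \<le> 1"
  shows "1 - p + p * exp (- l) \<le> exp (- l * p + l\<^sup>2 / 8)"
proof -
  have pos: "0 < 1 + (1 - p) * (exp l - 1)"
    using assms by (intro add_pos_nonneg mult_nonneg_nonneg) auto
  have "ln (1 + (1 - p) * (exp l - 1)) \<le> l * (1 - p) + l\<^sup>2 / 8"
    using ln_bernoulli_mgf_le[of l "1 - p"] assms by simp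
  hence le: "1 + (1 - p) * (exp l - 1) \<le> exp (l * (1 - p) + l\<^sup>2 / 8)"
    using pos by (metis exp_le_cancel_iff exp_ln)
  have "1 - p + p * exp (- l) = exp (- l) * (1 + (1 - p) * (exp l - 1))"
    by (simp add: algebra_simps exp_minus)
  also have "\<dots> \<le> exp (- l) * exp (l * (1 - p) + l\<^sup>2 / 8)"
    using le by simp
  also have "\<dots> = exp (- l * p + l\<^sup>2 / 8)" by (simp add: exp_add[symmetric] algebra_simps)
  finally show ?thesis .
qed

text \<open>Hoeffding's inequality by exponential tilting, with the probability measure written out
  as a weighted sum over words.\<close>

lemma words_count_lower_tail:
  fixes p :: "'a \<Rightarrow> real"
  assumes S: "finite S" and p: "\<And>y. y \<in> S \<Longrightarrow> p y \<ge> 0" and total: "(\<Sum>y\<in>S. p y) = 1"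
    and x: "x \<in> S" and s: "s \<ge> 0"
  shows "(\<Sum>w\<in>{w \<in> words S M. real (count (mset w) x) \<le> real M * p x - s}. prod_list (map p w))
    \<le> exp (- (2 * s\<^sup>2 / real M))"
proof -
  let ?B = "{w \<in> words S M. real (count (mset w) x) \<le> real M * p x - s}"
  \<comment> \<open>The minimiser of the exponent \<open>- l * s + M * l^2 / 8\<close>, with value
    \<open>- 2 * s^2 / M\<close>. For \<open>M = 0\<close> both quotients are 0 by convention and
    the bound reads 1.\<close>
  define l where "l = 4 * s / real M"
  have l: "l \<ge> 0" using s by (simp add: l_def)
  have fin: "finite (words S M)" by (rule finite_words[OF S])
  have pp: "prod_list (map p w) \<ge> 0" if "w \<in> words S M" for w
    using that p by (intro prod_list_nonneg) (auto simp: words_def)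
  have px: "p x \<le> 1" using member_le_sum[of x S p] x p S total by auto
  \<comment> \<open>The tilt is multiplicative over letters, so it can be absorbed into the letter
    weights and the sum over words becomes an \<open>M\<close>-th power.\<close>
  have mgf: "prod_list (map p w) * exp (- l * count (mset w) x)
      = prod_list (map (\<lambda>y. p y * (if y = x then exp (- l) else 1)) w)" for w
    by (induction w) (auto simp: algebra_simps exp_diff exp_add exp_minus divide_simps)
  have "(\<Sum>w\<in>?B. prod_list (map p w))
      \<le> (\<Sum>w\<in>?B. exp (l * (M * p x - s)) * (prod_list (map p w) * exp (- l * count (mset w) x)))"
  proof (rule sum_mono)
    fix w assume w: "w \<in> ?B"
    have "0 \<le> l * (M * p x - s - count (mset w) x)" using w l by (intro mult_nonneg_nonneg) auto
    hence "1 \<le> exp (l * (M * p x - s) + - l * count (mset w) x)"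
      by (simp add: algebra_simps)
    hence "prod_list (map p w) * 1
        \<le> prod_list (map p w) * exp (l * (M * p x - s) + - l * count (mset w) x)"
      using pp w by (intro mult_left_mono) auto
    thus "prod_list (map p w)
        \<le> exp (l * (M * p x - s)) * (prod_list (map p w) * exp (- l * count (mset w) x))"
      by (simp only: exp_add mult_ac mult_1_right)
  qed
  also have "\<dots> \<le> (\<Sum>w\<in>words S M. exp (l * (M * p x - s)) * (prod_list (map p w) * exp (- l * count (mset w) x)))"
    using fin pp by (intro sum_mono2) auto
  also have "\<dots> = exp (l * (M * p x - s)) * (\<Sum>y\<in>S. p y * (if y = x then exp (- l) else 1)) ^ M"
    unfolding mgf by (simp add: sum_distrib_left[symmetric] sum_words_prod_list)
  also have "(\<Sum>y\<in>S. p y * (if y = x then exp (- l) else 1)) = 1 - p x + p x * exp (- l)"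
    using total by (simp add: sum.remove[OF S x])
  also have "exp (l * (M * p x - s)) * \<dots> ^ M
      \<le> exp (l * (M * p x - s)) * exp (- l * p x + l\<^sup>2 / 8) ^ M"
    using bernoulli_mgf_bound[OF l p[OF x] px] p[OF x] px
    by (intro mult_left_mono power_mono) auto
  also have "\<dots> = exp (l * (M * p x - s) + M * (- l * p x + l\<^sup>2 / 8))"
    by (simp only: exp_add exp_of_nat_mult)
  also have "l * (M * p x - s) + M * (- l * p x + l\<^sup>2 / 8) = - (2 * s\<^sup>2 / real M)"
    by (cases "M = 0") (simp_all add: l_def field_simps power2_eq_square)
  finally show ?thesis .
qed

text \<open>Greedy rounding: each step adds a letter that is still strictly below its new target, so
  its count exceeds that target by less than 1 afterwards, while the targets of the others only
  grow.\<close>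

lemma exists_proportional_multiset:
  fixes p :: "'a \<Rightarrow> real"
  assumes S: "finite S" and p: "\<And>x. x \<in> S \<Longrightarrow> p x \<ge> 0" and total: "(\<Sum>x\<in>S. p x) = 1"
  shows "\<exists>m. set_mset m \<subseteq> S \<and> size m = L \<and> (\<forall>x\<in>S. real (count m x) < real L * p x + 1)"
proof (induction L)
  case 0
  show ?case by (intro exI[of _ "{#}"]) auto
next
  case (Suc L)
  then obtain m where m: "set_mset m \<subseteq> S" "size m = L" "\<And>x. x \<in> S \<Longrightarrow> real (count m x) < real L * p x + 1"
    by blast
  \<comment> \<open>The targets add up to \<open>L + 1\<close> but the counts only to
    \<open>L\<close>, so some letter is below its target.\<close>
  have "\<exists>x\<in>S. real (count m x) < real (Suc L) * p x"
  proof (rule ccontr)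
    assume "\<not> ?thesis"
    hence "(\<Sum>x\<in>S. real (Suc L) * p x) \<le> (\<Sum>x\<in>S. real (count m x))"
      by (intro sum_mono) (auto simp: not_less)
    also have "\<dots> = real (\<Sum>x\<in>set_mset m. count m x)"
      unfolding of_nat_sum using m(1) S by (intro sum.mono_neutral_right) (auto simp: count_eq_zero_iff)
    also have "\<dots> = real L" using m(2) by (simp add: size_multiset_overloaded_eq)
    finally show False using total by (simp add: sum_distrib_left[symmetric])
  qed
  then obtain x where x: "x \<in> S" "real (count m x) < real (Suc L) * p x" by blast
  have "real (count (add_mset x m) y) < real (Suc L) * p y + 1" if "y \<in> S" for y
    using x m(3)[OF that] p[OF that] by (cases "y = x") (auto simp: algebra_simps)
  thus ?case using m x by (intro exI[of _ "add_mset x m"]) auto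
qed

subsection \<open>Replication processes for the evolved state\<close>

lemma prod_list_map_eq_prod_mset: "prod_list (map f xs) = prod_mset (image_mset f (mset xs))"
  by (induction xs) auto

lemma sum_UN_le:
  fixes f :: "'a \<Rightarrow> real"
  assumes "finite I" "\<And>i. i \<in> I \<Longrightarrow> finite (B i)" "\<And>i x. i \<in> I \<Longrightarrow> x \<in> B i \<Longrightarrow> f x \<ge> 0"
  shows "sum f (\<Union>i\<in>I. B i) \<le> (\<Sum>i\<in>I. sum f (B i))"
  using assms
proof (induction I rule: finite_induct)
  case (insert i I)
  have "sum f (B i \<union> (\<Union>i\<in>I. B i)) + sum f (B i \<inter> (\<Union>i\<in>I. B i))
      = sum f (B i) + sum f (\<Union>i\<in>I. B i)"
    using insert by (intro sum.union_inter) auto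
  moreover have "sum f (B i \<inter> (\<Union>i\<in>I. B i)) \<ge> 0"
    using insert.prems by (intro sum_nonneg) auto
  moreover have "sum f (\<Union>i\<in>I. B i) \<le> (\<Sum>i\<in>I. sum f (B i))"
    using insert by auto
  ultimately show ?case using insert.hyps by simp
qed simp

text \<open>The weight lost is that of the words not containing \<open>m\<close>, each of which is
  deficient in some letter. The upper bound 1 is recorded too, since the asymptotic statement
  concerns the absolute value of \<open>1 - fidelity\<close>.\<close>

lemma exists_replication_process:
  fixes d N M :: nat and H :: "complex mat" and \<psi> :: "complex vec"
  assumes H: "hermitian_mat d H" and \<psi>: "\<psi> \<in> carrier_vec d" and unit: "\<psi> \<bullet>c \<psi> = 1" and NM: "N \<le> M"
  shows "\<exists>\<P>. replication_process d N M \<P> \<and> (\<forall>t. success_prob N \<P> (evolved H \<psi> t) \<noteq> 0) \<and>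
    fidelity N M \<P> (evolved H \<psi>) \<ge> 1 - real (num_energies H \<psi>) *
      exp (- (2 * (p_min H \<psi>)\<^sup>2 * (real N)\<^sup>2 / real M)) \<and>
    fidelity N M \<P> (evolved H \<psi>) \<le> 1"
proof -
  define S where "S = energy_support H \<psi>"
  define p where "p = outcome_prob H \<psi>"
  obtain g :: "complex \<Rightarrow> complex vec" where g: "\<And>E. g E \<in> carrier_vec d"
    and S: "finite S" "S \<subseteq> \<real>" and p: "\<And>E. E \<in> S \<Longrightarrow> p E > 0" and total: "(\<Sum>E\<in>S. p E) = 1"
    and orth: "\<And>E F. E \<noteq> F \<Longrightarrow> g E \<bullet>c g F = 0" and norm: "\<And>E. g E \<bullet>c g E = complex_of_real (p E)"
    and \<phi>: "\<And>t. evolved H \<psi> t \<in> carrier_vec d"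
    and expand: "\<And>t i. i < d \<Longrightarrow> evolved H \<psi> t $ i = (\<Sum>E\<in>S. exp (- \<i> * complex_of_real t * E) * g E $ i)"
    unfolding S_def p_def by (rule energy_decomposition[OF H \<psi> unit]) blast
  define a where "a t E = exp (- \<i> * complex_of_real t * E)" for t E
  have a: "cmod (a t E) = 1" if "E \<in> S" for t E
  proof -
    have "E \<in> \<real>" using that S(2) by blast
    then obtain r where "E = complex_of_real r" by (rule Reals_cases)
    thus ?thesis by (simp add: a_def norm_exp_eq_Re)
  qed
  have "S \<noteq> {}" using total by auto
  then obtain E0 where E0: "E0 \<in> S" by blast
  obtain m where m: "set_mset m \<subseteq> S" "size m = M - N"
    "\<And>E. E \<in> S \<Longrightarrow> real (count m E) < real (M - N) * p E + 1"
    using exists_proportional_multiset[OF S(1) _ total, of "M - N"] p by (meson less_imp_le)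
  define A where "A = {w \<in> words S M. m \<subseteq># mset w}"
  \<comment> \<open>Any ordering of the remaining letters will do, because the phase of a word
    depends only on its multiset.\<close>
  define u where "u w = (SOME v. mset v = mset w - m)" for w
  have mset_u: "mset (u w) = mset w - m" for w
    unfolding u_def by (rule someI_ex) (rule ex_mset)
  have u: "u w \<in> words S N" if "w \<in> A" for w
  proof -
    have w: "set w \<subseteq> S" "length w = M" "m \<subseteq># mset w" using that by (auto simp: A_def words_def)
    have "length (u w) = N"
      using w NM m(2) by (metis mset_u size_mset size_Diff_submset diff_diff_cancel)
    moreover have "set (u w) \<subseteq> S"
      using w(1) by (metis mset_u set_mset_mset in_diffD subset_iff)
    ultimately show ?thesis by (simp add: words_def)
  qed
  \<comment> \<open>Passing from \<open>w\<close> to \<open>u w\<close> removes the letters of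
    \<open>m\<close>, hence divides by their joint phase.\<close>
  define \<kappa> where "\<kappa> t = inverse (prod_mset (image_mset (a t) m))" for t
  have \<kappa>: "cmod (\<kappa> t) = 1" for t
  proof -
    obtain xs where xs: "mset xs = m" using ex_mset by blast
    hence "prod_mset (image_mset (a t) m) = prod_list (map (a t) xs)"
      by (simp add: prod_list_map_eq_prod_mset)
    moreover have "set xs \<subseteq> S" using xs m(1) by auto
    ultimately show ?thesis using cmod_prod_list_unit[of S "a t", OF a] by (simp add: \<kappa>_def norm_inverse)
  qed
  have phase: "prod_list (map (a t) (u w)) = \<kappa> t * prod_list (map (a t) w)" if "w \<in> A" for t w
  proof -
    have "mset w = m + (mset w - m)" using that by (simp add: A_def)
    hence "prod_mset (image_mset (a t) (mset w))
        = prod_mset (image_mset (a t) m) * prod_mset (image_mset (a t) (mset w - m))"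
      by (metis image_mset_union prod_mset_Un)
    moreover have "prod_mset (image_mset (a t) m) \<noteq> 0"
    proof
      assume "prod_mset (image_mset (a t) m) = 0"
      hence "\<kappa> t = 0" unfolding \<kappa>_def by (simp only: inverse_zero)
      thus False using \<kappa>[of t] by simp
    qed
    ultimately show ?thesis by (simp add: prod_list_map_eq_prod_mset mset_u \<kappa>_def field_simps)
  qed
  have A: "A \<subseteq> words S M" by (auto simp: A_def)
  \<comment> \<open>Padding \<open>m\<close> with \<open>N\<close> copies of one energy gives a word
    of length \<open>M\<close> in \<open>A\<close>.\<close>
  have "A \<noteq> {}"
  proof -
    obtain w where w: "mset w = m + replicate_mset N E0" using ex_mset by blast
    have "length w = M" using w m(2) NM by (metis size_mset size_union size_replicate_mset le_add_diff_inverse2)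
    moreover have "set w \<subseteq> S"
      using w m(1) E0 by (metis Un_subset_iff set_mset_mset set_mset_union set_mset_replicate_mset_subset
          empty_subsetI insert_subset)
    ultimately show ?thesis using w by (auto simp: A_def words_def)
  qed
  then obtain \<P> where \<P>: "replication_process d N M \<P>" "\<And>t. success_prob N \<P> (evolved H \<psi> t) \<noteq> 0"
    "fidelity N M \<P> (evolved H \<psi>) = (\<Sum>w\<in>A. prod_list (map p w))"
    using exists_filter_process[where \<phi> = "evolved H \<psi>" and a = a and g = g and p = p and \<kappa> = \<kappa> and u = u,
        OF S(1) g orth norm p \<phi> expand[folded a_def] a A _ u phase \<kappa>]
    by metis
  let ?pp = "\<lambda>w. prod_list (map p w)"
  let ?bad = "\<lambda>E. {w \<in> words S M. real (count (mset w) E) \<le> real M * p E - real N * p E}"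
  have fin: "finite (words S M)" by (rule finite_words[OF S(1)])
  have pp: "?pp w \<ge> 0" if "w \<in> words S M" for w
    using that prod_list_pos[of S p w, OF p] by (simp add: words_def)
  have sum_pp: "(\<Sum>w\<in>words S M. ?pp w) = 1" by (simp add: sum_words_prod_list total)
  have split: "(\<Sum>w\<in>A. ?pp w) + (\<Sum>w\<in>words S M - A. ?pp w) = 1"
    using sum.subset_diff[of A "words S M" ?pp] fin sum_pp by (auto simp: A_def)
  have cover: "words S M - A \<subseteq> (\<Union>E\<in>S. ?bad E)"
  proof
    fix w assume w: "w \<in> words S M - A"
    then obtain E where E: "count (mset w) E < count m E"
      by (auto simp: A_def subseteq_mset_def not_le)
    hence "E \<in> S" using m(1) by (metis count_inI gr_implies_not0 subset_iff)
    \<comment> \<open>Counts are integers, so a strict deficit is a deficit of at least 1; this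
      absorbs the rounding error in the counts of \<open>m\<close>, and no correction term
      remains.\<close>
    have "real (count (mset w) E) \<le> real (count m E) - 1" using E by linarith
    also have "\<dots> \<le> real (M - N) * p E" using m(3)[OF \<open>E \<in> S\<close>] by simp
    also have "\<dots> = real M * p E - real N * p E" using NM by (simp add: of_nat_diff algebra_simps)
    finally show "w \<in> (\<Union>E\<in>S. ?bad E)" using w \<open>E \<in> S\<close> by blast
  qed
  have p_min: "0 < p_min H \<psi>" "\<And>E. E \<in> S \<Longrightarrow> p_min H \<psi> \<le> p E"
    using S(1) \<open>S \<noteq> {}\<close> p by (auto simp: p_min_def S_def[symmetric] p_def[symmetric])
  have tail: "(\<Sum>w\<in>?bad E. ?pp w) \<le> exp (- (2 * (p_min H \<psi>)\<^sup>2 * (real N)\<^sup>2 / real M))" if E: "E \<in> S" for E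
  proof -
    \<comment> \<open>The tail bound is used with deviation \<open>s = N * p E\<close>, and
      \<open>p_min\<close> then makes it uniform in \<open>E\<close>.\<close>
    have "(\<Sum>w\<in>?bad E. ?pp w) \<le> exp (- (2 * (real N * p E)\<^sup>2 / real M))"
      using p E by (intro words_count_lower_tail[OF S(1) _ total E]) (simp_all add: less_imp_le)
    also have "\<dots> \<le> exp (- (2 * (p_min H \<psi>)\<^sup>2 * (real N)\<^sup>2 / real M))"
      using power_mono[OF p_min(2)[OF E], of 2] p_min(1)
      by (auto intro!: divide_right_mono mult_left_mono simp: power_mult_distrib mult_ac)
    finally show ?thesis .
  qed
  have "(\<Sum>w\<in>words S M - A. ?pp w) \<le> (\<Sum>w\<in>(\<Union>E\<in>S. ?bad E). ?pp w)"
    using cover fin S(1) pp by (intro sum_mono2) auto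
  also have "\<dots> \<le> (\<Sum>E\<in>S. \<Sum>w\<in>?bad E. ?pp w)"
    using S(1) fin pp by (intro sum_UN_le) auto
  also have "\<dots> \<le> real (card S) * exp (- (2 * (p_min H \<psi>)\<^sup>2 * (real N)\<^sup>2 / real M))"
    using tail by (intro sum_bounded_above)
  finally have "(\<Sum>w\<in>words S M - A. ?pp w)
      \<le> real (num_energies H \<psi>) * exp (- (2 * (p_min H \<psi>)\<^sup>2 * (real N)\<^sup>2 / real M))"
    by (simp add: num_energies_def S_def)
  moreover have "(\<Sum>w\<in>words S M - A. ?pp w) \<ge> 0" using pp by (intro sum_nonneg) auto
  ultimately show ?thesis using \<P> split by (intro exI[of _ \<P>]) auto
qed

lemma p_min_pos:
  assumes "hermitian_mat d H" "\<psi> \<in> carrier_vec d" "\<psi> \<bullet>c \<psi> = 1"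
  shows "p_min H \<psi> > 0"
proof (rule energy_decomposition[OF assms])
  fix g
  assume *: "finite (energy_support H \<psi>)" "\<And>E. E \<in> energy_support H \<psi> \<Longrightarrow> outcome_prob H \<psi> E > 0"
    "(\<Sum>E\<in>energy_support H \<psi>. outcome_prob H \<psi> E) = 1"
  hence "energy_support H \<psi> \<noteq> {}" by auto
  thus ?thesis using * by (simp add: p_min_def)
qed

section \<open>Decay faster than any inverse polynomial\<close>

lemma exp_powr_smallo_inverse_power:
  fixes c b :: real
  assumes "c > 0" "b > 0"
  shows "(\<lambda>n. exp (- (c * real n powr b))) \<in> o(\<lambda>n. 1 / real n ^ k)"
  using assms by real_asymp

text \<open>For \<open>n \<ge> 1\<close> each monomial of \<open>q\<close> is at most a constant
  times the top power. Roots must be excluded first, since there the convention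
  \<open>1 / 0 = 0\<close> would break the bound; they are finitely many.\<close>

lemma inverse_power_bigo_inverse_poly:
  fixes q :: "real poly"
  assumes "q \<noteq> 0"
  shows "(\<lambda>n. 1 / real n ^ degree q) \<in> O(\<lambda>n. 1 / poly q (real n))"
proof (rule bigoI)
  define C where "C = (\<Sum>i\<le>degree q. \<bar>coeff q i\<bar>)"
  have "finite {x. poly q x = 0}" using assms by (rule poly_roots_finite)
  hence "finite {n. poly q (real n) = 0}"
    using finite_vimageI[of "{x. poly q x = 0}" real] by (simp add: vimage_def inj_on_def)
  hence "eventually (\<lambda>n. poly q (real n) \<noteq> 0) sequentially"
    by (simp add: cofinite_eq_sequentially[symmetric] eventually_cofinite)
  thus "eventually (\<lambda>n. norm (1 / real n ^ degree q) \<le> C * norm (1 / poly q (real n))) sequentially"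
    using eventually_ge_at_top[of 1]
  proof eventually_elim
    case (elim n)
    have "\<bar>poly q (real n)\<bar> \<le> (\<Sum>i\<le>degree q. \<bar>coeff q i\<bar> * real n ^ i)"
      unfolding poly_altdef by (rule order.trans[OF sum_abs]) (simp add: abs_mult)
    also have "\<dots> \<le> (\<Sum>i\<le>degree q. \<bar>coeff q i\<bar> * real n ^ degree q)"
      using elim by (intro sum_mono mult_left_mono power_increasing) auto
    finally have "\<bar>poly q (real n)\<bar> \<le> C * real n ^ degree q" by (simp add: C_def sum_distrib_right)
    thus ?case using elim by (simp add: field_simps)
  qed
qed

text \<open>The growth bound \<open>M N \<le> C * N powr \<alpha>\<close> makes
  \<open>N^2 / M N\<close> at least \<open>N powr (2 - \<alpha>) / C\<close>, a positive power of
  \<open>N\<close> because \<open>\<alpha> < 2\<close>.\<close>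

lemma superpolynomial_of_exp_bound:
  fixes F :: "nat \<Rightarrow> real" and M :: "nat \<Rightarrow> nat" and q :: "real poly"
  assumes M: "(\<lambda>N. real (M N)) \<in> O(\<lambda>N. real N powr \<alpha>)" "\<And>N. N \<le> M N" and \<alpha>: "\<alpha> < 2" and c: "c > 0"
    and F: "\<And>N. F N \<le> 1" "\<And>N. F N \<ge> 1 - K * exp (- (c * (real N)\<^sup>2 / real (M N)))"
    and K: "K \<ge> 0" and q: "q \<noteq> 0"
  shows "(\<lambda>N. 1 - F N) \<in> o(\<lambda>N. 1 / poly q (real N))"
proof -
  obtain C where C: "C > 0" and ev: "eventually (\<lambda>N. real (M N) \<le> C * real N powr \<alpha>) sequentially"
    using M(1) by (elim landau_o.bigE) auto
  have "(\<lambda>N. 1 - F N) \<in> O(\<lambda>N. exp (- (c / C * real N powr (2 - \<alpha>))))"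
  proof (rule bigoI)
    show "eventually (\<lambda>N. norm (1 - F N) \<le> K * norm (exp (- (c / C * real N powr (2 - \<alpha>))))) sequentially"
      using ev eventually_gt_at_top[of 0]
    proof eventually_elim
      case (elim N)
      have "c / C * real N powr (2 - \<alpha>) = c * (real N)\<^sup>2 / (C * real N powr \<alpha>)"
        using elim by (simp add: powr_diff powr_numeral)
      \<comment> \<open>\<open>0 < N\<close> and \<open>N \<le> M N\<close> keep the denominator
        positive.\<close>
      also have "\<dots> \<le> c * (real N)\<^sup>2 / real (M N)"
        using elim c C M(2)[of N] by (intro divide_left_mono) auto
      finally have "K * exp (- (c * (real N)\<^sup>2 / real (M N))) \<le> K * exp (- (c / C * real N powr (2 - \<alpha>)))"
        using K by (intro mult_left_mono) auto
      thus ?case using F(1)[of N] F(2)[of N] by simp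
    qed
  qed
  also have "(\<lambda>N. exp (- (c / C * real N powr (2 - \<alpha>)))) \<in> o(\<lambda>N. 1 / real N ^ degree q)"
    using c C \<alpha> by (intro exp_powr_smallo_inverse_power) auto
  also have "(\<lambda>N. 1 / real N ^ degree q) \<in> O(\<lambda>N. 1 / poly q (real N))"
    by (rule inverse_power_bigo_inverse_poly[OF q])
  finally show ?thesis .
qed

theorem mainTheorem3:
  fixes d :: nat and H :: "complex mat" and \<psi> :: "complex vec"
  assumes "hermitian_mat d H"
    and "\<psi> \<in> carrier_vec d"
    and "\<psi> \<bullet>c \<psi> = 1"
    and "\<not> (\<exists>E. eigenvector H \<psi> E)"
  shows
    "(\<forall>M N :: nat. N \<le> M \<and> 1 / p_min H \<psi> \<le> real N \<longrightarrow>
        (\<exists>\<P>. replication_process d N M \<P> \<and>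
             (\<forall>t. success_prob N \<P> (evolved H \<psi> t) \<noteq> 0) \<and>
             fidelity N M \<P> (evolved H \<psi>) \<ge>
               1 - 2 * real (num_energies H \<psi>) *
                 exp (- (2 * (p_min H \<psi>)\<^sup>2 * (real N)\<^sup>2 / real M)
                      + 4 * real N / (real M * real (num_energies H \<psi>))))) \<and>
     (\<forall>(\<alpha> :: real) (M :: nat \<Rightarrow> nat).
        1 \<le> \<alpha> \<and> \<alpha> < 2 \<and> (\<forall>N. N \<le> M N) \<and>
        (\<lambda>N. real (M N)) \<in> \<Theta>(\<lambda>N. real N powr \<alpha>) \<longrightarrow>
        (\<exists>\<P> :: nat \<Rightarrow> complex mat \<Rightarrow> complex mat.
           (\<forall>N. replication_process d N (M N) (\<P> N) \<and>
                (\<forall>t. success_prob N (\<P> N) (evolved H \<psi> t) \<noteq> 0)) \<and>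
           (\<forall>q :: real poly. q \<noteq> 0 \<longrightarrow>
              (\<lambda>N. 1 - fidelity N (M N) (\<P> N) (evolved H \<psi>)) \<in> o(\<lambda>N. 1 / poly q (real N)))))"
proof (intro conjI allI impI, goal_cases)
  case (1 M N)
  let ?K = "real (num_energies H \<psi>)"
  let ?b = "2 * (p_min H \<psi>)\<^sup>2 * (real N)\<^sup>2 / real M"
  obtain \<P> where \<P>: "replication_process d N M \<P>" "\<forall>t. success_prob N \<P> (evolved H \<psi> t) \<noteq> 0"
    "fidelity N M \<P> (evolved H \<psi>) \<ge> 1 - ?K * exp (- ?b)"
    using exists_replication_process[OF assms(1-3), of N M] 1 by blast
  \<comment> \<open>Doubling the prefactor and adding a nonnegative term to the exponent only
    enlarge the error.\<close>
  have "?K * exp (- ?b) \<le> (2 * ?K) * exp (- ?b + 4 * real N / (real M * ?K))"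
    by (intro mult_mono) auto
  hence "fidelity N M \<P> (evolved H \<psi>) \<ge> 1 - 2 * ?K * exp (- ?b + 4 * real N / (real M * ?K))"
    using \<P>(3) by linarith
  thus ?case using \<P>(1,2) by blast
next
  case (2 \<alpha> M)
  have NM: "N \<le> M N" for N using 2 by blast
  have "\<forall>N. \<exists>\<P>. replication_process d N (M N) \<P> \<and> (\<forall>t. success_prob N \<P> (evolved H \<psi> t) \<noteq> 0) \<and>
      fidelity N (M N) \<P> (evolved H \<psi>) \<ge> 1 - real (num_energies H \<psi>) *
        exp (- (2 * (p_min H \<psi>)\<^sup>2 * (real N)\<^sup>2 / real (M N))) \<and>
      fidelity N (M N) \<P> (evolved H \<psi>) \<le> 1"
    by (intro allI exists_replication_process assms NM)
  from choice[OF this] obtain \<P> where \<P>: "\<And>N. replication_process d N (M N) (\<P> N)"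
    "\<And>N t. success_prob N (\<P> N) (evolved H \<psi> t) \<noteq> 0"
    "\<And>N. fidelity N (M N) (\<P> N) (evolved H \<psi>) \<ge> 1 - real (num_energies H \<psi>) *
      exp (- (2 * (p_min H \<psi>)\<^sup>2 * (real N)\<^sup>2 / real (M N)))"
    "\<And>N. fidelity N (M N) (\<P> N) (evolved H \<psi>) \<le> 1"
    by blast
  have "(\<lambda>N. 1 - fidelity N (M N) (\<P> N) (evolved H \<psi>)) \<in> o(\<lambda>N. 1 / poly q (real N))"
    if "q \<noteq> 0" for q
  proof (rule superpolynomial_of_exp_bound[OF _ NM _ _ \<P>(4,3) _ that])
    show "(\<lambda>N. real (M N)) \<in> O(\<lambda>N. real N powr \<alpha>)" "\<alpha> < 2" using 2 by (auto simp: bigtheta_def)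
    show "0 < 2 * (p_min H \<psi>)\<^sup>2" using p_min_pos[OF assms(1-3)] by simp
  qed simp
  thus ?case using \<P>(1,2) by blast
qed

end
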